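(* Let $n\geq 2$ be an integer and $\mathbb{K}$ a field of characteristic $0$ or $\geq 2n+1$. Suppose that $\mathbb{K}$ is $2(n-1)!!$-radically closed. Let $G = \operatorname{SL}_2(\mathbb{K})$ and let $V$ be a $G$-module (i.e. a $\mathbb{Z}[G]$-module). Let $\mathbb{K}_1$ be the prime subfield of $\mathbb{K}$ and $G_1 = \operatorname{SL}_2(\mathbb{K}_1)$. Suppose that $V$ is a $\mathbb{K}_1$-vector space such that $V \simeq \bigoplus_I \operatorname{Sym}^{n-1} \operatorname{Nat} G_1$ as $\mathbb{K}_1[G_1]$-modules, for some index set $I$. Then $V$ bears a compatible $\mathbb{K}$-vector space structure for which $V \simeq\bigoplus_J \operatorname{Sym}^{n-1}\operatorname{Nat} G$ as $\mathbb{K}[G]$-modules, for some index set $J$.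
   Context: $G=\operatorname{SL}_2(\mathbb{K})$ is regarded as an abstract group. The double factorial is $m!! = m(m-2)(m-4)\cdots$ (product of the positive integers of the same parity as $m$ up to $m$). A field $\mathbb{K}$ is $k$-radically closed if for every $\alpha$ in an algebraic closure $\overline{\mathbb{K}}$, $\alpha^k\in\mathbb{K}$ implies $\alpha\in\mathbb{K}$. $\operatorname{Nat} \operatorname{SL}_2(F)$ is $F^2$ with the natural action and $\operatorname{Sym}^{n-1}\operatorname{Nat}\operatorname{SL}_2(F)$ is its $(n-1)$-th symmetric power over $F$, i.e. homogeneous polynomials of degree $n-1$ in two variables over $F$ with the substitution action. $\bigoplus_I M$ denotes a direct sum of copies of $M$ indexed by $I$. *)

theory Defs
  imports "HOL-Analysis.Analysis" "HOL-Computational_Algebra.Polynomial"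
begin

fun dfact :: "nat \<Rightarrow> nat" where
  "dfact 0 = 1"
| "dfact (Suc 0) = 1"
| "dfact (Suc (Suc m)) = Suc (Suc m) * dfact m"

text \<open>k-radically closed: every alpha in an algebraic closure with alpha^k in K lies in K.
  Equivalently (this is what it unfolds to): for every a in K, all roots of X^k - a
  (in the algebraic closure) lie in K, i.e. X^k - a splits into linear factors over K.\<close>
definition radically_closed :: "nat \<Rightarrow> 'k::field itself \<Rightarrow> bool" where
  "radically_closed k _ \<longleftrightarrow>
     (\<forall>a::'k. \<exists>rs::'k list. monom 1 k - [:a:] = prod_list (map (\<lambda>r. [:-r, 1:]) rs))"

definition is_subfield :: "'k::field set \<Rightarrow> bool" where
  "is_subfield S \<longleftrightarrow> 0 \<in> S \<and> 1 \<in> S \<and> (\<forall>x\<in>S. \<forall>y\<in>S. x + y \<in> S \<and> x - y \<in> S \<and> x * y \<in> S)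
     \<and> (\<forall>x\<in>S. inverse x \<in> S)"

definition prime_subfield :: "'k::field set" where
  "prime_subfield = \<Inter>{S. is_subfield S}"

definition SL2 :: "'k::field set \<Rightarrow> ('k^2^2) set" where
  "SL2 F = {A. (\<forall>i j. A $ i $ j \<in> F) \<and> det A = 1}"

definition is_G_module :: "('k::field^2^2 \<Rightarrow> 'v::ab_group_add \<Rightarrow> 'v) \<Rightarrow> bool" where
  "is_G_module act \<longleftrightarrow>
     (\<forall>g\<in>SL2 UNIV. \<forall>u v. act g (u + v) = act g u + act g v) \<and>
     (\<forall>v. act (mat 1) v = v) \<and>
     (\<forall>g\<in>SL2 UNIV. \<forall>h\<in>SL2 UNIV. \<forall>v. act (g ** h) v = act g (act h v))"

definition is_vs_over :: "'k::field set \<Rightarrow> ('k \<Rightarrow> 'v::ab_group_add \<Rightarrow> 'v) \<Rightarrow> bool" where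
  "is_vs_over F smul \<longleftrightarrow>
     (\<forall>a\<in>F. \<forall>u v. smul a (u + v) = smul a u + smul a v) \<and>
     (\<forall>a\<in>F. \<forall>b\<in>F. \<forall>u. smul (a + b) u = smul a u + smul b u) \<and>
     (\<forall>a\<in>F. \<forall>b\<in>F. \<forall>u. smul (a * b) u = smul a (smul b u)) \<and>
     (\<forall>u. smul 1 u = u)"

text \<open>Sym^m Nat: homogeneous polynomials of degree m in x,y, encoded by dehomogenisation
  P(x,y) = sum_i p_i x^i y^(m-i)  <->  p = sum_i p_i t^i (a univariate polynomial of degree <= m).
  The substitution action of g = [[a,b],[c,d]] is P(x,y) |-> P(ax+cy, bx+dy)
  (i.e. (g.P)(v) = P(g^T v), a left action), which in the encoding reads
  p |-> sum_i p_i (a t + c)^i (b t + d)^(m-i).\<close>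
definition sym_act :: "nat \<Rightarrow> 'k::field^2^2 \<Rightarrow> 'k poly \<Rightarrow> 'k poly" where
  "sym_act m g p = (\<Sum>i\<le>m. smult (coeff p i)
        ([:g $ 2 $ 1, g $ 1 $ 1:] ^ i * [:g $ 2 $ 2, g $ 1 $ 2:] ^ (m - i)))"

definition dsum_sym :: "'k::field set \<Rightarrow> nat \<Rightarrow> 'i set \<Rightarrow> ('i \<Rightarrow> 'k poly) set" where
  "dsum_sym F m I = {f. finite {i. f i \<noteq> 0} \<and> (\<forall>i. i \<notin> I \<longrightarrow> f i = 0) \<and>
      (\<forall>i\<in>I. degree (f i) \<le> m \<and> (\<forall>j. coeff (f i) j \<in> F))}"

definition is_sym_iso :: "'k::field set \<Rightarrow> nat \<Rightarrow> ('k \<Rightarrow> 'v::ab_group_add \<Rightarrow> 'v)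
    \<Rightarrow> ('k^2^2 \<Rightarrow> 'v \<Rightarrow> 'v) \<Rightarrow> 'i set \<Rightarrow> ('v \<Rightarrow> 'i \<Rightarrow> 'k poly) \<Rightarrow> bool" where
  "is_sym_iso F m smul act I \<phi> \<longleftrightarrow>
     bij_betw \<phi> UNIV (dsum_sym F m I) \<and>
     (\<forall>u v. \<phi> (u + v) = (\<lambda>i. \<phi> u i + \<phi> v i)) \<and>
     (\<forall>c\<in>F. \<forall>v. \<phi> (smul c v) = (\<lambda>i. smult c (\<phi> v i))) \<and>
     (\<forall>g\<in>SL2 F. \<forall>v. \<phi> (act g v) = (\<lambda>i. sym_act m g (\<phi> v i)))"

end

(*
  Let m = n - 1. On V, which is Sym^m tensored with a K_1-space M, every group element acts by an
  (m + 1) x (m + 1)-matrix with entries in End(M). Write u_a, v_a for the upper and lower unipotents.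

  Since u_a commutes with u_1, its matrix is triangular. The torus of SL_2(K_1) rescales the d-th
  diagonal by l^(2d), and these weights are distinct because the characteristic is large; this forces
  u_a = exp(x Phi(a)), where x is the standard nilpotent on Sym^m and Phi : K -> End(M) is additive,
  and likewise v_a = exp(y Phi(a)) after conjugation by the Weyl element. The Weyl element
  w_a = u_a v_{-1/a} u_a exchanges the extreme weight spaces, and the first column of
  v_{1/a} w_a = u_a v_{-1/a} gives Phi(1/a) = Phi(a)^(-1). The Phi(a) commute, so
  1/a - 1/(a + 1) = 1/(a (a + 1)) gives Phi(a^2) = Phi(a)^2, and Phi is a ring homomorphism.
  It makes M a K-vector space and V the corresponding sum of copies of Sym^m.
*)
theory Submission
  imports Defs
begin

section \<open>Two by two matrices and symmetric powers\<close>

definition mat2 :: "'k \<Rightarrow> 'k \<Rightarrow> 'k \<Rightarrow> 'k \<Rightarrow> 'k::field^2^2" where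
  "mat2 a b c d = vector [vector [a, b], vector [c, d]]"

lemma mat2_nth [simp]:
  "mat2 a b c d $ 1 $ 1 = a" "mat2 a b c d $ 1 $ 2 = b"
  "mat2 a b c d $ 2 $ 1 = c" "mat2 a b c d $ 2 $ 2 = d"
  by (simp_all add: mat2_def)

lemma mat2_eta: "mat2 (g $ 1 $ 1) (g $ 1 $ 2) (g $ 2 $ 1) (g $ 2 $ 2) = g"
  by (simp add: vec_eq_iff forall_2)

lemma mat2_mult:
  "mat2 a b c d ** mat2 a' b' c' d' =
   mat2 (a * a' + b * c') (a * b' + b * d') (c * a' + d * c') (c * b' + d * d')"
  by (simp add: vec_eq_iff forall_2 matrix_matrix_mult_def sum_2)

lemma mat2_in_SL2: "mat2 a b c d \<in> SL2 F \<longleftrightarrow> {a, b, c, d} \<subseteq> F \<and> a * d - b * c = 1"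
  by (auto simp: SL2_def forall_2 det_2)

lemma SL2_mult_closed: "g \<in> SL2 UNIV \<Longrightarrow> h \<in> SL2 UNIV \<Longrightarrow> g ** h \<in> SL2 UNIV"
  by (simp add: SL2_def det_mul)

abbreviation upper :: "'k \<Rightarrow> 'k::field^2^2" where "upper a \<equiv> mat2 1 a 0 1"
abbreviation lower :: "'k \<Rightarrow> 'k::field^2^2" where "lower a \<equiv> mat2 1 0 a 1"
abbreviation weyl :: "'k \<Rightarrow> 'k::field^2^2" where "weyl a \<equiv> mat2 0 a (- inverse a) 0"

text \<open>SL_2 over a field is generated by its unipotents: a matrix with nonzero lower left entry
  is an upper, a lower and an upper one multiplied together, and the other matrices reduce to this
  case.\<close>

lemma SL2_induct [consumes 1, case_names upper lower mult]:
  fixes g :: "'k::field^2^2"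
  assumes "g \<in> SL2 UNIV"
    and upper: "\<And>a. P (upper a)" and lower: "\<And>a. P (lower a)"
    and mult: "\<And>g h. g \<in> SL2 UNIV \<Longrightarrow> h \<in> SL2 UNIV \<Longrightarrow> P g \<Longrightarrow> P h \<Longrightarrow> P (g ** h)"
  shows "P g"
proof -
  have *: "P (mat2 a b c d)" if "a * d - b * c = 1" "c \<noteq> 0" for a b c d
  proof -
    have "a * ((d - 1) / c) + (a - 1) / c = b"
      using that by (simp add: field_simps)
    then have "mat2 a b c d = (upper ((a - 1) / c) ** lower c) ** upper ((d - 1) / c)"
      using that by (simp add: mat2_mult)
    moreover have "P ((upper ((a - 1) / c) ** lower c) ** upper ((d - 1) / c))"
      by (intro mult upper lower SL2_mult_closed) (simp_all add: mat2_in_SL2)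
    ultimately show ?thesis by simp
  qed
  obtain a b c d where g: "g = mat2 a b c d" using mat2_eta[of g] by metis
  with assms(1) have det: "a * d - b * c = 1" by (simp add: mat2_in_SL2)
  show ?thesis
  proof (cases "c = 0")
    case False
    with * det g show ?thesis by simp
  next
    case True
    \<comment> \<open>Now \<open>c = 0\<close>, so \<open>d\<close> is nonzero. Adding the second
      column to the first puts \<open>d\<close> into the lower left corner, and
      \<open>lower (- 1)\<close> undoes this.\<close>
    have "mat2 a b c d = mat2 (a + b) b (c + d) d ** lower (- 1)"
      by (simp add: mat2_mult)
    moreover have "P (mat2 (a + b) b (c + d) d ** lower (- 1))"
      using det True by (intro mult * lower) (auto simp: mat2_in_SL2 algebra_simps)
    ultimately show ?thesis by (simp add: g)
  qed
qed

section \<open>The symmetric power in the monomial basis\<close>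

text \<open>The row is \<open>j\<close>, the column is \<open>i\<close>. Columns with
  \<open>i > m\<close> vanish, because \<open>sym_act\<close> reads no coefficients beyond
  \<open>m\<close>; hence the bound \<open>i \<le> m\<close> below.\<close>

definition sym_coeff :: "nat \<Rightarrow> 'k::field^2^2 \<Rightarrow> nat \<Rightarrow> nat \<Rightarrow> 'k" where
  "sym_coeff m g j i = coeff (sym_act m g (monom 1 i)) j"

lemma smult_sum_right: "smult c (\<Sum>x\<in>A. f x) = (\<Sum>x\<in>A. smult c (f x))"
  by (induction A rule: infinite_finite_induct) (simp_all add: smult_add_right)

lemma sym_act_add: "sym_act m g (p + q) = sym_act m g p + sym_act m g q"
  by (simp add: sym_act_def smult_add_left sum.distrib)

lemma sym_act_smult: "sym_act m g (smult c p) = smult c (sym_act m g p)"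
  by (simp add: sym_act_def smult_sum_right)

lemma sym_act_sum: "sym_act m g (sum f A) = (\<Sum>x\<in>A. sym_act m g (f x))"
  by (induction A rule: infinite_finite_induct) (simp_all add: sym_act_add, simp_all add: sym_act_def)

lemma sym_act_monom:
  "i \<le> m \<Longrightarrow> sym_act m g (monom c i) =
     smult c ([:g $ 2 $ 1, g $ 1 $ 1:] ^ i * [:g $ 2 $ 2, g $ 1 $ 2:] ^ (m - i))"
  by (simp add: sym_act_def if_distrib[of "\<lambda>c. smult c _"] cong: if_cong)

lemma degree_sym_act: "degree (sym_act m g p) \<le> m"
  unfolding sym_act_def
proof (intro degree_sum_le finite_atMost)
  fix i assume "i \<in> {..m}"
  then have "degree ([:g $ 2 $ 1, g $ 1 $ 1:] ^ i * [:g $ 2 $ 2, g $ 1 $ 2:] ^ (m - i)) \<le> 1 * i + 1 * (m - i)"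
    by (intro order.trans[OF degree_mult_le] add_mono order.trans[OF degree_power_le] mult_right_mono)
       auto
  with \<open>i \<in> {..m}\<close> show "degree (smult (coeff p i) ([:g $ 2 $ 1, g $ 1 $ 1:] ^ i * [:g $ 2 $ 2, g $ 1 $ 2:] ^ (m - i))) \<le> m"
    by (intro order.trans[OF degree_smult_le]) auto
qed

lemma poly_eq_sum_monom: "degree p \<le> m \<Longrightarrow> p = (\<Sum>i\<le>m. monom (coeff p i) i)"
  by (rule poly_as_sum_of_monoms'[symmetric])

lemma coeff_sym_act: "degree p \<le> m \<Longrightarrow> coeff (sym_act m g p) j = (\<Sum>i\<le>m. sym_coeff m g j i * coeff p i)"
proof -
  assume "degree p \<le> m"
  then have "sym_act m g p = (\<Sum>i\<le>m. smult (coeff p i) (sym_act m g (monom 1 i)))"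
    by (subst poly_eq_sum_monom[of p m], assumption)
       (simp add: sym_act_sum smult_monom flip: sym_act_smult)
  then show ?thesis
    by (simp add: coeff_sum sym_coeff_def mult.commute)
qed

text \<open>Substituting linear forms is multiplicative on homogeneous polynomials. In the
  dehomogenised encoding the formal degree has to be carried along, and it adds up.\<close>

lemma sym_act_mult:
  fixes p q :: "'a::field poly"
  assumes "degree p \<le> m" "degree q \<le> n"
  shows "sym_act (m + n) g (p * q) = sym_act m g p * sym_act n g q"
proof -
  have "p * q = (\<Sum>i\<le>m. \<Sum>j\<le>n. monom (coeff p i * coeff q j) (i + j))"
    by (subst poly_eq_sum_monom[OF assms(1)], subst poly_eq_sum_monom[OF assms(2)])
       (simp add: sum_product mult_monom)
  also have "sym_act (m + n) g \<dots> = (\<Sum>i\<le>m. \<Sum>j\<le>n. sym_act m g (monom (coeff p i) i) * sym_act n g (monom (coeff q j) j))"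
    unfolding sym_act_sum
  proof (intro sum.cong refl, goal_cases)
    case (1 i j)
    then have "m + n - (i + j) = (m - i) + (n - j)" by simp
    then have *: "B ^ (m + n - (i + j)) = B ^ (m - i) * B ^ (n - j)" for B :: "'a poly"
      by (simp only: power_add)
    from 1 show ?case by (simp add: sym_act_monom * power_add[of _ i j] mult_ac)
  qed
  also have "\<dots> = sym_act m g (\<Sum>i\<le>m. monom (coeff p i) i) * sym_act n g (\<Sum>j\<le>n. monom (coeff q j) j)"
    by (simp add: sym_act_sum sum_product)
  finally show ?thesis
    using assms by (simp flip: poly_eq_sum_monom)
qed

lemma sym_act_one_linear:
  "sym_act (Suc 0) g [:a, b:] = smult a [:g $ 2 $ 2, g $ 1 $ 2:] + smult b [:g $ 2 $ 1, g $ 1 $ 1:]"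
  by (simp add: sym_act_def)

lemma sym_act_linear_power:
  "sym_act i g ([:a, b:] ^ i) = (smult a [:g $ 2 $ 2, g $ 1 $ 2:] + smult b [:g $ 2 $ 1, g $ 1 $ 1:]) ^ i"
proof (induction i)
  case 0
  show ?case by (simp add: sym_act_def)
next
  case (Suc i)
  have "degree ([:a, b:] ^ i) \<le> i"
    using degree_power_le[of "[:a, b:]" i] by (cases "b = 0") auto
  then have "sym_act (1 + i) g ([:a, b:] * [:a, b:] ^ i) = sym_act 1 g [:a, b:] * sym_act i g ([:a, b:] ^ i)"
    by (intro sym_act_mult) auto
  then show ?case
    by (simp add: Suc.IH sym_act_one_linear del: smult_pCons mult_pCons_left)
qed

text \<open>A monomial goes to a product of powers of two linear forms, so multiplicativity reduces
  the claim to degree one, where it is the matrix product.\<close>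

lemma sym_act_compose:
  assumes "degree p \<le> m"
  shows "sym_act m (g ** h) p = sym_act m g (sym_act m h p)"
proof -
  have *: "sym_act m (g ** h) (monom c i) = sym_act m g (sym_act m h (monom c i))" if "i \<le> m" for i c
  proof -
    let ?A = "[:h $ 2 $ 1, h $ 1 $ 1:]" and ?B = "[:h $ 2 $ 2, h $ 1 $ 2:]"
    have "degree (?A ^ i) \<le> i" "degree (?B ^ (m - i)) \<le> m - i"
      using degree_power_le[of ?A i] degree_power_le[of ?B "m - i"]
      by (auto split: if_splits)
    then have "sym_act (i + (m - i)) g (?A ^ i * ?B ^ (m - i)) = sym_act i g (?A ^ i) * sym_act (m - i) g (?B ^ (m - i))"
      by (rule sym_act_mult)
    then show ?thesis
      using that
      by (simp add: sym_act_monom sym_act_smult sym_act_linear_power matrix_matrix_mult_def sum_2 algebra_simps)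
  qed
  show ?thesis
    by (subst (1 2) poly_eq_sum_monom[OF assms]) (simp add: sym_act_sum *)
qed

lemma sym_coeff_mult:
  assumes "i \<le> m"
  shows "sym_coeff m (g ** h) j i = (\<Sum>l\<le>m. sym_coeff m g j l * sym_coeff m h l i)"
  using coeff_sym_act[OF degree_sym_act, of m g h "monom 1 i" j] assms
  by (simp add: sym_coeff_def sym_act_compose degree_monom_eq)

lemma linear_power_eq_monom: "[:0, a:] ^ k = monom (a ^ k) k"
  by (induction k) (simp_all add: monom_Suc smult_monom)

lemma const_power: "[:a:] ^ k = [:a ^ k:]"
  by (induction k) (simp_all add: mult.commute)

lemma coeff_monic_linear_power:
  "coeff ([:1::'k::field, a:] ^ n) j = of_nat (n choose j) * a ^ j"
proof (induction n arbitrary: j)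
  case 0
  show ?case by (cases j) auto
next
  case (Suc n)
  show ?case by (cases j) (auto simp: Suc.IH algebra_simps)
qed

text \<open>These are the entries of exp (a x), where x sends t^i to (m - i) t^(i+1): the d-th
  divided power of x has the coefficient \<open>(m - i) choose d\<close>.\<close>

lemma sym_coeff_upper:
  assumes "i \<le> m"
  shows "sym_coeff m (upper a) j i = (if i \<le> j then of_nat ((m - i) choose (j - i)) * a ^ (j - i) else 0)"
proof -
  have "sym_act m (upper a) (monom 1 i) = monom 1 i * [:1, a:] ^ (m - i)"
    using assms by (simp add: sym_act_monom linear_power_eq_monom)
  then show ?thesis
    by (simp add: sym_coeff_def coeff_monom_mult coeff_monic_linear_power)
qed

lemma coeff_linear_power:
  "j \<le> n \<Longrightarrow> coeff ([:a, 1::'k::field:] ^ n) j = of_nat (n choose j) * a ^ (n - j)"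
proof (induction n arbitrary: j)
  case 0
  then show ?case by simp
next
  case (Suc n)
  have *: "coeff ([:a, 1:] ^ n) k = 0" if "k > n" for k
    using degree_linear_power[of a n] that by (simp add: coeff_eq_0)
  show ?case
  proof (cases j)
    case 0
    then show ?thesis by (simp add: Suc.IH)
  next
    case (Suc k)
    show ?thesis
    proof (cases "j \<le> n")
      case True
      then have "n - k = Suc (n - j)" using Suc by simp
      with True Suc show ?thesis using Suc.IH[of j] Suc.IH[of k] by (simp add: algebra_simps)
    next
      case False
      then have "k = n" using Suc Suc.prems by simp
      then show ?thesis using Suc * Suc.IH[of n] by simp
    qed
  qed
qed

text \<open>Likewise exp (a y), where y sends t^i to i t^(i-1).\<close>

lemma sym_coeff_lower:
  assumes "i \<le> m"
  shows "sym_coeff m (lower a) j i = (if j \<le> i then of_nat (i choose j) * a ^ (i - j) else 0)"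
proof -
  have "sym_act m (lower a) (monom 1 i) = [:a, 1:] ^ i"
    using assms by (simp add: sym_act_monom flip: one_pCons)
  then show ?thesis
    using coeff_linear_power[of j i a] degree_linear_power[of a i]
    by (auto simp: sym_coeff_def coeff_eq_0)
qed

lemma sym_coeff_diagonal:
  assumes "i \<le> m"
  shows "sym_coeff m (mat2 a 0 0 b) j i = (if j = i then a ^ i * b ^ (m - i) else 0)"
proof -
  have "sym_act m (mat2 a 0 0 b) (monom 1 i) = monom (a ^ i * b ^ (m - i)) i"
    using assms by (simp add: sym_act_monom linear_power_eq_monom const_power smult_monom mult.commute)
  then show ?thesis by (simp add: sym_coeff_def)
qed

lemma sym_coeff_antidiagonal:
  assumes "i \<le> m"
  shows "sym_coeff m (mat2 0 a b 0) j i = (if i + j = m then a ^ j * b ^ i else 0)"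
proof -
  have "sym_act m (mat2 0 a b 0) (monom 1 i) = monom (a ^ (m - i) * b ^ i) (m - i)"
    using assms by (simp add: sym_act_monom linear_power_eq_monom const_power smult_monom mult.commute)
  then show ?thesis using assms by (auto simp: sym_coeff_def)
qed

section \<open>Matrix representations over a noncommutative ring\<close>

lemma is_subfield_prime_subfield: "is_subfield (prime_subfield :: 'k::field set)"
  unfolding is_subfield_def prime_subfield_def by blast

lemma prime_subfield_closed:
  "0 \<in> (prime_subfield :: 'k::field set)" "1 \<in> (prime_subfield :: 'k set)"
  "(x::'k) \<in> prime_subfield \<Longrightarrow> y \<in> prime_subfield \<Longrightarrow> x + y \<in> prime_subfield"
  "(x::'k) \<in> prime_subfield \<Longrightarrow> y \<in> prime_subfield \<Longrightarrow> x - y \<in> prime_subfield"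
  "(x::'k) \<in> prime_subfield \<Longrightarrow> y \<in> prime_subfield \<Longrightarrow> x * y \<in> prime_subfield"
  "(x::'k) \<in> prime_subfield \<Longrightarrow> inverse x \<in> prime_subfield"
  using is_subfield_prime_subfield unfolding is_subfield_def by auto

lemma uminus_in_prime_subfield: "(x::'k::field) \<in> prime_subfield \<Longrightarrow> - x \<in> prime_subfield"
  using prime_subfield_closed(4)[OF prime_subfield_closed(1)] by fastforce

lemma of_nat_in_prime_subfield: "of_nat q \<in> (prime_subfield :: 'k::field set)"
  by (induction q) (auto intro: prime_subfield_closed)

lemma power_in_prime_subfield: "(x::'k::field) \<in> prime_subfield \<Longrightarrow> x ^ d \<in> prime_subfield"
  by (induction d) (auto intro: prime_subfield_closed)

lemma sum_in_prime_subfield: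
  "(\<And>x. x \<in> A \<Longrightarrow> f x \<in> (prime_subfield :: 'k::field set)) \<Longrightarrow> sum f A \<in> prime_subfield"
  by (induction A rule: infinite_finite_induct) (auto intro: prime_subfield_closed)

lemma sum_eq_single:
  "finite A \<Longrightarrow> a \<in> A \<Longrightarrow> (\<And>x. x \<in> A \<Longrightarrow> x \<noteq> a \<Longrightarrow> f x = 0) \<Longrightarrow> sum f A = f a"
  by (subst sum.mono_neutral_right[of A "{a}"]) auto

lemma sum_eq_pair:
  assumes "finite A" "a \<in> A" "b \<in> A" "a \<noteq> b" "\<And>x. x \<in> A \<Longrightarrow> x \<noteq> a \<Longrightarrow> x \<noteq> b \<Longrightarrow> f x = 0"
  shows "sum f A = f a + f b"
  using assms by (subst sum.mono_neutral_right[of A "{a, b}"]) auto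

text \<open>Naturals are central in every ring, which takes the place of commutativity.\<close>

lemma of_nat_mult_power:
  fixes x :: "'r::semiring_1"
  shows "(of_nat q * x) ^ d = of_nat (q ^ d) * x ^ d"
proof (induction d)
  case (Suc d)
  have "(of_nat q * x) ^ Suc d = of_nat q * (x * of_nat (q ^ d)) * x ^ d"
    by (simp add: Suc.IH mult.assoc)
  also have "x * of_nat (q ^ d) = of_nat (q ^ d) * x"
    by (rule mult_of_nat_commute[symmetric])
  finally show ?case by (simp add: mult.assoc)
qed simp

lemma mult_of_nat_left_commute: "x * (of_nat q * y) = of_nat q * (x * (y :: 'r::semiring_1))"
  by (metis mult.assoc mult_of_nat_commute)

lemma of_nat_mult_mult:
  "(of_nat p * x) * (of_nat q * y) = of_nat (p * q) * (x * (y :: 'r::semiring_1))"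
  by (simp add: mult.assoc mult_of_nat_left_commute[of x])

lemma of_nat_of_nat_mult:
  "of_nat p * (of_nat q * x) = of_nat (p * q) * (x :: 'r::semiring_1)"
  by (simp add: mult.assoc)

section \<open>Matrix representations: the setting and the role of the characteristic\<close>

text \<open>The ring \<open>'r\<close> stands for End(M), where V is Sym^m tensored with M, and
  \<open>\<rho> g j i\<close> for the block of g in row \<open>j\<close> and column
  \<open>i\<close>. Only the values of \<open>s\<close> on the prime subfield are
  constrained.\<close>

locale sl2_matrix_rep =
  fixes m :: nat
    and s :: "'k::field \<Rightarrow> 'r::ring_1"
    and \<rho> :: "'k^2^2 \<Rightarrow> nat \<Rightarrow> nat \<Rightarrow> 'r"
  assumes m_pos: "0 < m"
    and char: "CHAR('k) = 0 \<or> 2 * m + 1 < CHAR('k)"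
    and s_add: "x \<in> prime_subfield \<Longrightarrow> y \<in> prime_subfield \<Longrightarrow> s (x + y) = s x + s y"
    and s_mult: "x \<in> prime_subfield \<Longrightarrow> y \<in> prime_subfield \<Longrightarrow> s (x * y) = s x * s y"
    and s_one: "s 1 = 1"
    and \<rho>_mult: "g \<in> SL2 UNIV \<Longrightarrow> h \<in> SL2 UNIV \<Longrightarrow> j \<le> m \<Longrightarrow> i \<le> m \<Longrightarrow>
      \<rho> (g ** h) j i = (\<Sum>l\<le>m. \<rho> g j l * \<rho> h l i)"
    and \<rho>_prime: "g \<in> SL2 prime_subfield \<Longrightarrow> j \<le> m \<Longrightarrow> i \<le> m \<Longrightarrow> \<rho> g j i = s (sym_coeff m g j i)"
begin

lemma s_zero: "s 0 = 0"
  using s_add[of 0 0] by (simp add: prime_subfield_closed)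

lemma s_uminus: "x \<in> prime_subfield \<Longrightarrow> s (- x) = - s x"
  using s_add[of x "- x"]
  by (simp add: uminus_in_prime_subfield s_zero eq_neg_iff_add_eq_0 add.commute)

lemma s_of_nat: "s (of_nat q) = of_nat q"
  by (induction q) (simp_all add: s_zero s_one s_add prime_subfield_closed of_nat_in_prime_subfield)

lemma s_power: "x \<in> prime_subfield \<Longrightarrow> s (x ^ d) = s x ^ d"
  by (induction d) (simp_all add: s_one s_mult power_in_prime_subfield)

text \<open>A natural that is nonzero in K is a unit of \<open>'r\<close>: its inverse lies in the
  prime subfield and is carried over by \<open>s\<close>.\<close>

lemma of_nat_cancel:
  assumes "of_nat q \<noteq> (0::'k)" and "of_nat q * x = of_nat q * (y :: 'r)"
  shows "x = y"
proof -
  have "s (inverse (of_nat q)) * of_nat q = s (inverse (of_nat q) * of_nat q)"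
    by (simp only: s_mult s_of_nat prime_subfield_closed of_nat_in_prime_subfield)
  then have *: "s (inverse (of_nat q)) * of_nat q = 1"
    using assms(1) by (simp add: s_one)
  have "s (inverse (of_nat q)) * (of_nat q * x) = s (inverse (of_nat q)) * (of_nat q * y)"
    by (simp only: assms(2))
  then show ?thesis by (simp only: mult.assoc[symmetric] * mult_1_left)
qed

lemma of_nat_neq_0: "0 < q \<Longrightarrow> q \<le> 2 * m + 1 \<Longrightarrow> of_nat q \<noteq> (0::'k)"
  using char by (auto simp: of_nat_eq_0_iff_char_dvd dest: dvd_imp_le)

lemma of_nat_binomial_neq_0:
  assumes "j \<le> m"
  shows "of_nat (m choose j) \<noteq> (0::'k)"
proof -
  have "of_nat (fact k) \<noteq> (0::'k)" if "k \<le> m" for k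
    using that
  proof (induction k)
    case (Suc k)
    have "of_nat (fact (Suc k)) = (of_nat (Suc k) * of_nat (fact k) :: 'k)"
      by (simp only: fact_Suc of_nat_mult of_nat_id)
    with Suc of_nat_neq_0[of "Suc k"] show ?case by simp
  qed simp
  then have "of_nat (fact j * fact (m - j) * (m choose j)) \<noteq> (0::'k)"
    using assms by (simp only: binomial_fact_lemma not_False_eq_True)
  then show ?thesis by (metis of_nat_mult mult_zero_right)
qed

text \<open>The polynomial X^(2d) - 1 has at most 2d roots, while 1, ..., 2d + 1 are distinct and
  nonzero in K. This is the source of the bound \<open>2 * m + 1\<close> on the
  characteristic.\<close>

lemma exists_nat_power_neq_1:
  assumes "0 < d" "d \<le> m"
  shows "\<exists>\<mu>::nat. of_nat \<mu> \<noteq> (0::'k) \<and> of_nat \<mu> ^ (2 * d) \<noteq> (1::'k)"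
proof (rule ccontr)
  let ?p = "monom 1 (2 * d) - 1 :: 'k poly"
  assume *: "\<not> ?thesis"
  have "of_nat q ^ (2 * d) = (1::'k)" if "q \<in> {1..2 * d + 1}" for q
  proof -
    have "of_nat q \<noteq> (0::'k)" using that assms by (intro of_nat_neq_0) auto
    with * show ?thesis by blast
  qed
  then have "of_nat ` {1..2 * d + 1} \<subseteq> {x::'k. poly ?p x = 0}"
    by (auto simp: poly_monom)
  moreover have p: "?p \<noteq> 0" "degree ?p \<le> 2 * d"
  proof -
    have "coeff ?p (2 * d) = 1" using assms by simp
    then show "?p \<noteq> 0" by (metis coeff_0 zero_neq_one)
    show "degree ?p \<le> 2 * d" by (intro degree_diff_le) (auto simp: degree_monom_le)
  qed
  ultimately have "card (of_nat ` {1..2 * d + 1} :: 'k set) \<le> card {x. poly ?p x = 0}"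
    by (intro card_mono poly_roots_finite)
  also have "\<dots> \<le> degree ?p" by (rule card_poly_roots_bound[OF p(1)])
  also note p(2)
  finally have "card (of_nat ` {1..2 * d + 1} :: 'k set) \<le> 2 * d" .
  moreover have "inj_on (of_nat :: nat \<Rightarrow> 'k) {1..2 * d + 1}"
  proof (rule linorder_inj_onI)
    fix x y :: nat assume *: "x < y" "x \<in> {1..2 * d + 1}" "y \<in> {1..2 * d + 1}"
    then have "of_nat (y - x) \<noteq> (0::'k)" using assms by (intro of_nat_neq_0) auto
    with * show "of_nat x \<noteq> (of_nat y :: 'k)" by (simp add: of_nat_diff)
  qed auto
  ultimately show False by (simp add: card_image)
qed

text \<open>If two torus weights agree on \<open>x\<close>, then \<open>x\<close> is killed by a
  difference of powers of \<open>\<mu>\<close>, which is a unit for a suitable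
  \<open>\<mu>\<close>.\<close>

lemma distinct_weights:
  fixes x :: 'r
  assumes "a < b" "b \<le> a + m"
    and "\<And>\<mu>. of_nat \<mu> \<noteq> (0::'k) \<Longrightarrow> of_nat (\<mu> ^ (2 * a)) * x = of_nat (\<mu> ^ (2 * b)) * x"
  shows "x = 0"
proof -
  obtain \<mu> where \<mu>: "of_nat \<mu> \<noteq> (0::'k)" "of_nat \<mu> ^ (2 * (b - a)) \<noteq> (1::'k)"
    using exists_nat_power_neq_1[of "b - a"] assms(1,2) by force
  \<comment> \<open>The truncated subtraction is exact, since \<open>\<mu>\<close> is positive and
    \<open>a < b\<close>.\<close>
  define q where "q = \<mu> ^ (2 * b) - \<mu> ^ (2 * a)"
  have "\<mu> \<noteq> 0" using \<mu>(1) by (rule contrapos_nn) simp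
  then have le: "\<mu> ^ (2 * a) \<le> \<mu> ^ (2 * b)" using assms(1) by (intro power_increasing) auto
  have "(of_nat \<mu> :: 'k) ^ (2 * b) = of_nat \<mu> ^ (2 * a) * of_nat \<mu> ^ (2 * (b - a))"
    using assms(1) by (simp add: right_diff_distrib' flip: power_add)
  then have "of_nat q = (of_nat \<mu> :: 'k) ^ (2 * a) * (of_nat \<mu> ^ (2 * (b - a)) - 1)"
    using le by (simp add: q_def of_nat_diff right_diff_distrib)
  then have "of_nat q \<noteq> (0::'k)" using \<mu> by simp
  moreover have "of_nat q * x = of_nat q * 0"
    using assms(3)[OF \<mu>(1)] le by (simp add: q_def of_nat_diff left_diff_distrib)
  ultimately show ?thesis by (rule of_nat_cancel)
qed

section \<open>Torus weights\<close>

abbreviation torus :: "nat \<Rightarrow> 'k^2^2" where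
  "torus \<mu> \<equiv> mat2 (of_nat \<mu>) 0 0 (inverse (of_nat \<mu>))"

lemma torus_offdiagonal:
  "of_nat \<mu> \<noteq> (0::'k) \<Longrightarrow> j \<le> m \<Longrightarrow> i \<le> m \<Longrightarrow> j \<noteq> i \<Longrightarrow> \<rho> (torus \<mu>) j i = 0"
  by (subst \<rho>_prime)
     (simp_all add: mat2_in_SL2 prime_subfield_closed of_nat_in_prime_subfield sym_coeff_diagonal s_zero)

text \<open>The entry is \<open>\<mu>\<close> to the power 2i - m; the factor
  \<open>\<mu> ^ m\<close> clears a possibly negative exponent. Taking \<open>\<mu>\<close> natural
  keeps all these factors central.\<close>

lemma torus_diagonal:
  assumes "of_nat \<mu> \<noteq> (0::'k)" "i \<le> m"
  shows "of_nat (\<mu> ^ m) * \<rho> (torus \<mu>) i i = of_nat (\<mu> ^ (2 * i))"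
proof -
  define x :: 'k where "x = of_nat \<mu> ^ i * inverse (of_nat \<mu>) ^ (m - i)"
  have x: "x \<in> prime_subfield"
    unfolding x_def by (intro prime_subfield_closed power_in_prime_subfield of_nat_in_prime_subfield)
  have "\<rho> (torus \<mu>) i i = s x"
    using assms by (subst \<rho>_prime)
      (simp_all add: mat2_in_SL2 prime_subfield_closed of_nat_in_prime_subfield sym_coeff_diagonal x_def)
  moreover have "of_nat (\<mu> ^ m) * s x = s (of_nat (\<mu> ^ m) * x)"
    by (simp only: s_mult[OF of_nat_in_prime_subfield x] s_of_nat)
  moreover have "of_nat (\<mu> ^ m) * x = of_nat (\<mu> ^ (2 * i))"
  proof -
    have "(of_nat \<mu> :: 'k) ^ m = of_nat \<mu> ^ i * of_nat \<mu> ^ (m - i)"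
      using assms(2) by (simp flip: power_add)
    then show ?thesis using assms(1)
      by (simp add: x_def field_simps mult_2_right power_add)
  qed
  ultimately show ?thesis by (simp only: s_of_nat)
qed

lemma torus_mult_left:
  assumes "of_nat \<mu> \<noteq> (0::'k)" "g \<in> SL2 UNIV" "j \<le> m" "i \<le> m"
  shows "of_nat (\<mu> ^ m) * \<rho> (torus \<mu> ** g) j i = of_nat (\<mu> ^ (2 * j)) * \<rho> g j i"
proof -
  have "\<rho> (torus \<mu> ** g) j i = \<rho> (torus \<mu>) j j * \<rho> g j i"
    using assms by (subst \<rho>_mult; (intro sum_eq_single)?) (auto simp: mat2_in_SL2 torus_offdiagonal)
  then show ?thesis
    by (simp only: mult.assoc[symmetric] torus_diagonal[OF assms(1,3)])
qed

lemma torus_mult_right: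
  assumes "of_nat \<mu> \<noteq> (0::'k)" "g \<in> SL2 UNIV" "j \<le> m" "i \<le> m"
  shows "of_nat (\<mu> ^ m) * \<rho> (g ** torus \<mu>) j i = of_nat (\<mu> ^ (2 * i)) * \<rho> g j i"
proof -
  have "\<rho> (g ** torus \<mu>) j i = \<rho> g j i * \<rho> (torus \<mu>) i i"
    using assms by (subst \<rho>_mult; (intro sum_eq_single)?) (auto simp: mat2_in_SL2 torus_offdiagonal)
  then have "of_nat (\<mu> ^ m) * \<rho> (g ** torus \<mu>) j i = \<rho> g j i * (of_nat (\<mu> ^ m) * \<rho> (torus \<mu>) i i)"
    by (simp only: mult_of_nat_left_commute)
  then show ?thesis
    by (simp only: torus_diagonal[OF assms(1,4)]) (simp only: mult_of_nat_commute)
qed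

section \<open>Upper unipotents are exponentials\<close>

abbreviation U :: "'k \<Rightarrow> nat \<Rightarrow> nat \<Rightarrow> 'r" where "U a \<equiv> \<rho> (upper a)"
abbreviation L :: "'k \<Rightarrow> nat \<Rightarrow> nat \<Rightarrow> 'r" where "L a \<equiv> \<rho> (lower a)"
abbreviation W :: "'k \<Rightarrow> nat \<Rightarrow> nat \<Rightarrow> 'r" where "W a \<equiv> \<rho> (weyl a)"

lemma upper_in_SL2: "upper a \<in> SL2 UNIV" and lower_in_SL2: "lower a \<in> SL2 UNIV"
  and weyl_in_SL2: "b \<noteq> 0 \<Longrightarrow> weyl b \<in> SL2 UNIV"
  by (simp_all add: mat2_in_SL2)

lemma U_add: "j \<le> m \<Longrightarrow> i \<le> m \<Longrightarrow> U (a + b) j i = (\<Sum>l\<le>m. U a j l * U b l i)"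
  by (simp add: upper_in_SL2 mat2_mult add.commute flip: \<rho>_mult)

text \<open>Conjugation by the torus sends \<open>upper a\<close> to
  \<open>upper (\<mu>^2 * a)\<close>. Hence scaling \<open>a\<close> by the square of
  \<open>\<mu>\<close> scales the entry by \<open>\<mu>\<close> to the power 2(j - i), written here
  without denominators.\<close>

lemma U_scale:
  assumes "of_nat \<mu> \<noteq> (0::'k)" "j \<le> m" "i \<le> m"
  shows "of_nat (\<mu> ^ (2 * j)) * U a j i = of_nat (\<mu> ^ (2 * i)) * U (of_nat (\<mu> ^ 2) * a) j i"
proof -
  have "torus \<mu> ** upper a = upper (of_nat (\<mu> ^ 2) * a) ** torus \<mu>"
    using assms(1) by (simp add: mat2_mult power2_eq_square field_simps)
  then show ?thesis
    by (simp only: torus_mult_left[OF assms(1) upper_in_SL2 assms(2,3), symmetric]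
      torus_mult_right[OF assms(1) upper_in_SL2 assms(2,3), symmetric])
qed

lemma U_0: "i \<le> m \<Longrightarrow> U 0 i i = 1"
  by (subst \<rho>_prime) (simp_all add: mat2_in_SL2 prime_subfield_closed sym_coeff_upper s_one)

lemma U_1: "j \<le> m \<Longrightarrow> i \<le> m \<Longrightarrow> U 1 j i = (if i \<le> j then of_nat ((m - i) choose (j - i)) else 0)"
  by (subst \<rho>_prime) (simp_all add: mat2_in_SL2 prime_subfield_closed sym_coeff_upper s_of_nat s_zero)

text \<open>Commuting with \<open>upper 1\<close> already forces triangularity. The induction runs
  through increasing rows and, within a row, through decreasing columns.\<close>

lemma U_below: "j < i \<Longrightarrow> i \<le> m \<Longrightarrow> U a j i = 0"
proof (induction j arbitrary: i rule: less_induct)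
  case (less j)
  note row = less.IH
  from less.prems show ?case
  proof (induction "m - i" arbitrary: i rule: less_induct)
    case (less i)
    then obtain k where k: "i = Suc k" "j \<le> k" "k < m" by (cases i) auto
    \<comment> \<open>Entry (j, k), with k = i - 1, of \<open>upper a\<close> times
      \<open>upper 1\<close> in both orders. The induction hypotheses leave \<open>U a j k\<close>,
      which cancels, and \<open>m - k\<close> times \<open>U a j i\<close>.\<close>
    have "(\<Sum>l\<le>m. U a j l * U 1 l k) = U a j k * U 1 k k + U a j i * U 1 i k"
    proof (rule sum_eq_pair)
      fix l assume l: "l \<in> {..m}" "l \<noteq> k" "l \<noteq> i"
      show "U a j l * U 1 l k = 0"
      proof (cases "l < k")
        case True
        with k l show ?thesis by (simp add: U_1)
      next
        case False
        with k l less.prems show ?thesis by (simp add: less.hyps)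
      qed
    qed (use k in auto)
    moreover have "(\<Sum>l\<le>m. U 1 j l * U a l k) = U 1 j j * U a j k"
    proof (rule sum_eq_single)
      fix l assume l: "l \<in> {..m}" "l \<noteq> j"
      show "U 1 j l * U a l k = 0"
      proof (cases "l < j")
        case True
        with k l show ?thesis by (simp add: row)
      next
        case False
        with k l show ?thesis by (simp add: U_1)
      qed
    qed (use k in auto)
    moreover have "(\<Sum>l\<le>m. U a j l * U 1 l k) = (\<Sum>l\<le>m. U 1 j l * U a l k)"
      using U_add[of j k a 1] U_add[of j k 1 a] k by (simp add: add.commute)
    ultimately have "of_nat (m - k) * U a j i = of_nat (m - k) * 0"
      using k by (simp add: U_1 mult_of_nat_commute del: of_nat_diff)
    moreover have "of_nat (m - k) \<noteq> (0::'k)" using k by (intro of_nat_neq_0) auto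
    ultimately show ?case using of_nat_cancel by blast
  qed
qed

lemma U_add_band:
  assumes "i + d \<le> m"
  shows "U (a + b) (i + d) i = (\<Sum>e\<le>d. U a (i + d) (i + e) * U b (i + e) i)"
proof -
  have "U (a + b) (i + d) i = (\<Sum>l\<in>{0 + i..d + i}. U a (i + d) l * U b l i)"
    using assms by (subst U_add; (intro sum.mono_neutral_right)?) (auto simp: U_below not_le)
  also have "\<dots> = (\<Sum>e\<in>{0..d}. U a (i + d) (e + i) * U b (e + i) i)"
    by (rule sum.shift_bounds_cl_nat_ivl)
  finally show ?thesis by (simp add: atMost_atLeast0 add.commute)
qed

text \<open>A diagonal entry is multiplicative in \<open>a\<close>, yet unchanged when
  \<open>a\<close> is scaled by the square of \<open>\<mu>\<close>.\<close>

lemma U_diagonal: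
  assumes "i \<le> m"
  shows "U a i i = 1"
proof -
  have add: "U (b + c) i i = U b i i * U c i i" for b c
    using U_add_band[of i 0] assms by simp
  obtain \<mu> where \<mu>: "of_nat \<mu> \<noteq> (0::'k)" "of_nat \<mu> ^ 2 \<noteq> (1::'k)"
    using exists_nat_power_neq_1[of 1] m_pos by auto
  \<comment> \<open>Chosen so that scaling \<open>b\<close> by the square of \<open>\<mu>\<close>
    gives \<open>b + a\<close>. The entries at \<open>b\<close> and at \<open>b + a\<close> then
    agree, and the one at \<open>- b\<close> cancels the common factor.\<close>
  define b where "b = a / (of_nat \<mu> ^ 2 - 1)"
  have "of_nat (\<mu> ^ (2 * i)) \<noteq> (0::'k)" using \<mu>(1) by simp
  then have "U b i i = U (of_nat (\<mu> ^ 2) * b) i i"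
    using U_scale[OF \<mu>(1) assms assms] by (rule of_nat_cancel)
  also have "of_nat (\<mu> ^ 2) * b = b + a"
    using \<mu>(2) by (simp add: b_def field_simps)
  finally have "U (- b) i i * U b i i = U (- b) i i * (U b i i * U a i i)"
    by (simp only: add)
  then have "U (- b + b) i i = U (- b + b) i i * U a i i"
    unfolding add mult.assoc .
  then show ?thesis by (simp add: U_0 assms)
qed

definition \<Phi> :: "'k \<Rightarrow> 'r" where "\<Phi> a = U a m (m - 1)"

lemma \<Phi>_add: "\<Phi> (a + b) = \<Phi> a + \<Phi> b"
  using U_add_band[of "m - 1" 1 a b] m_pos
  by (simp add: \<Phi>_def U_diagonal add.commute)

lemma \<Phi>_prime: "a \<in> prime_subfield \<Longrightarrow> \<Phi> a = s a"
  unfolding \<Phi>_def using m_pos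
  by (subst \<rho>_prime) (simp_all add: mat2_in_SL2 prime_subfield_closed sym_coeff_upper)

lemma \<Phi>_of_nat: "\<Phi> (of_nat q) = of_nat q"
  by (simp add: \<Phi>_prime of_nat_in_prime_subfield s_of_nat)

lemma \<Phi>_0: "\<Phi> 0 = 0" and \<Phi>_1: "\<Phi> 1 = 1"
  using \<Phi>_of_nat[of 0] \<Phi>_of_nat[of 1] by simp_all

lemma \<Phi>_uminus: "\<Phi> (- a) = - \<Phi> a"
  using \<Phi>_add[of a "- a"] by (simp add: \<Phi>_0 eq_neg_iff_add_eq_0 add.commute)

lemma \<Phi>_diff: "\<Phi> (a - b) = \<Phi> a - \<Phi> b"
  using \<Phi>_add[of a "- b"] by (simp add: \<Phi>_uminus)

lemma \<Phi>_sum: "\<Phi> (sum f A) = (\<Sum>x\<in>A. \<Phi> (f x))"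
  by (induction A rule: infinite_finite_induct) (simp_all add: \<Phi>_0 \<Phi>_add)

lemma \<Phi>_of_nat_mult: "\<Phi> (of_nat q * a) = of_nat q * \<Phi> a"
  by (induction q) (simp_all add: \<Phi>_0 \<Phi>_add distrib_right)

lemma U_add_second:
  assumes "i + 2 \<le> m"
  shows "U (a + b) (i + 2) i = U a (i + 2) i + U a (i + 2) (i + 1) * U b (i + 1) i + U b (i + 2) i"
proof -
  have "{..2::nat} = {0, 1, 2}" by auto
  then show ?thesis
    using assms U_add_band[OF assms, of a b] by (simp add: U_diagonal add.assoc)
qed

text \<open>Expand the entry for \<open>a + b\<close> and for \<open>b + a\<close>: the unmixed
  terms cancel.\<close>

lemma U_second_commute:
  assumes "i + 2 \<le> m"
  shows "U a (i + 2) (i + 1) * U b (i + 1) i = U b (i + 2) (i + 1) * U a (i + 1) i"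
  using U_add_second[OF assms, of a b] U_add_second[OF assms, of b a]
  by (simp add: algebra_simps)

text \<open>Downward induction from \<open>i = m - 1\<close>: commutation with
  \<open>upper 1\<close> ties each entry of this diagonal to the next one.\<close>

lemma U_superdiagonal: "i < m \<Longrightarrow> U a (i + 1) i = of_nat (m - i) * \<Phi> a"
proof (induction "m - i" arbitrary: i rule: less_induct)
  case (less i)
  show ?case
  proof (cases "i + 1 = m")
    case True
    then have "m - i = 1" "i = m - 1" by auto
    with True show ?thesis by (simp add: \<Phi>_def)
  next
    case False
    with less.prems have i: "i + 2 \<le> m" by simp
    have "U a (i + 2) (i + 1) = of_nat (m - (i + 1)) * \<Phi> a"
      using less.hyps[of "i + 1"] i by (simp add: add.assoc)
    moreover have "U 1 (i + 1) i = of_nat (m - i)" "U 1 (i + 2) (i + 1) = of_nat (m - (i + 1))"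
      using i by (simp_all add: U_1)
    ultimately have "of_nat (m - (i + 1)) * (\<Phi> a * of_nat (m - i)) = of_nat (m - (i + 1)) * U a (i + 1) i"
      using U_second_commute[OF i, of a 1] by (simp only: mult.assoc)
    moreover have "of_nat (m - (i + 1)) \<noteq> (0::'k)" using i by (intro of_nat_neq_0) auto
    ultimately have "\<Phi> a * of_nat (m - i) = U a (i + 1) i" by (rule of_nat_cancel[rotated])
    then show ?thesis by (simp only: mult_of_nat_commute)
  qed
qed

text \<open>Let \<open>D\<close> be the deviation from the exponential formula on band
  \<open>d\<close>. Once the lower bands are known, \<open>D\<close> is additive along multiples of
  \<open>a\<close>, so it scales with weight 2; the torus gives it weight 2d. For
  \<open>d \<ge> 2\<close> these weights differ.\<close>

lemma U_band: "i + d \<le> m \<Longrightarrow> U a (i + d) i = of_nat ((m - i) choose d) * \<Phi> a ^ d"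
proof (induction d arbitrary: i a rule: less_induct)
  case (less d)
  consider "d = 0" | "d = 1" | "2 \<le> d" by linarith
  then show ?case
  proof cases
    case 1
    with less.prems show ?thesis by (simp add: U_diagonal)
  next
    case 2
    with less.prems show ?thesis using U_superdiagonal[of i a] by simp
  next
    case 3
    define c where "c = (m - i) choose d"
    define D where "D b = U b (i + d) i - of_nat c * \<Phi> b ^ d" for b
    have U_eq: "U b (i + d) i = of_nat c * \<Phi> b ^ d + D b" for b
      by (simp add: D_def)
    \<comment> \<open>Only multiples of the single element \<open>a\<close> occur, so all powers
      involved are powers of \<open>\<Phi> a\<close> and the binomial theorem applies before the
      values of \<open>\<Phi>\<close> are known to commute.\<close>
    have D_mult: "D (of_nat q * a) = of_nat q * D a" for q
    proof (induction q)
      case 0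
      have "U 0 (i + d) i = 0"
        using 3 less.prems
        by (subst \<rho>_prime) (simp_all add: mat2_in_SL2 prime_subfield_closed sym_coeff_upper s_zero power_0_left)
      with 3 show ?case by (simp add: D_def \<Phi>_0 power_0_left)
    next
      case (Suc q)
      let ?b = "of_nat q * a"
      let ?f = "\<lambda>e. U ?b (i + d) (i + e) * U a (i + e) i"
      let ?T = "\<lambda>e. of_nat (c * ((d choose e) * q ^ (d - e))) * \<Phi> a ^ d"
      \<comment> \<open>The end terms are the unknown entries of band \<open>d\<close> and carry the
        deviations. The inner ones come from the induction hypothesis, their two binomials
        multiplying to \<open>c * (d choose e)\<close>.\<close>
      have *: "?f e = ?T e + (if e = 0 then D ?b else 0) + (if e = d then D a else 0)"
        if e: "e \<le> d" for e
      proof -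
        consider "e = 0" | "e = d" | "0 < e" "e < d" using e by linarith
        then show ?thesis
        proof cases
          case 1
          then show ?thesis using 3 less.prems
            by (simp add: U_diagonal U_eq \<Phi>_of_nat_mult of_nat_mult_power mult.assoc)
        next
          case 2
          then show ?thesis using 3 less.prems by (simp add: U_diagonal U_eq)
        next
          case 3
          have "U ?b ((i + e) + (d - e)) (i + e) = of_nat ((m - (i + e)) choose (d - e)) * \<Phi> ?b ^ (d - e)"
            using 3 less.prems by (intro less.IH) auto
          moreover have "U a (i + e) i = of_nat ((m - i) choose e) * \<Phi> a ^ e"
            using 3 less.prems by (intro less.IH) auto
          moreover have "((m - i) choose e) * ((m - (i + e)) choose (d - e)) = c * (d choose e)"
            using choose_mult[of e d "m - i"] 3 less.prems by (simp add: c_def)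
          moreover have "\<Phi> a ^ (d - e) * \<Phi> a ^ e = \<Phi> a ^ d"
            using 3 by (simp flip: power_add)
          moreover have "\<Phi> ?b ^ (d - e) = of_nat (q ^ (d - e)) * \<Phi> a ^ (d - e)"
            by (simp only: \<Phi>_of_nat_mult of_nat_mult_power)
          moreover have "(i + e) + (d - e) = i + d" using 3 by simp
          ultimately have "?f e = (of_nat ((m - (i + e)) choose (d - e)) * (of_nat (q ^ (d - e)) * \<Phi> a ^ (d - e)))
              * (of_nat ((m - i) choose e) * \<Phi> a ^ e)"
            by (simp only:)
          also have "\<dots> = ?T e"
          proof -
            have "((m - (i + e)) choose (d - e)) * q ^ (d - e) * ((m - i) choose e) = c * ((d choose e) * q ^ (d - e))"
              using \<open>_ = c * (d choose e)\<close> by (metis mult.assoc mult.commute)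
            then show ?thesis
              unfolding of_nat_of_nat_mult of_nat_mult_mult \<open>\<Phi> a ^ (d - e) * _ = _\<close> by (simp only:)
          qed
          finally show ?thesis using 3 by simp
        qed
      qed
      have "(\<Sum>e\<le>d. (d choose e) * q ^ (d - e)) = Suc q ^ d"
        using binomial_ring[of 1 q d] by simp
      then have T: "(\<Sum>e\<le>d. ?T e) = of_nat (c * Suc q ^ d) * \<Phi> a ^ d"
        by (simp only: sum_distrib_right[symmetric] of_nat_sum[symmetric] sum_distrib_left[symmetric])
      have "U (of_nat (Suc q) * a) (i + d) i = U (?b + a) (i + d) i"
        by (simp add: algebra_simps)
      also have "\<dots> = (\<Sum>e\<le>d. ?f e)"
        by (rule U_add_band[OF less.prems])
      also have "\<dots> = of_nat (c * Suc q ^ d) * \<Phi> a ^ d + D ?b + D a"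
        by (simp add: * sum.distrib T del: of_nat_mult of_nat_power)
      finally show ?case
        unfolding U_eq
        by (simp only: \<Phi>_of_nat_mult of_nat_mult_power of_nat_mult mult.assoc Suc.IH add.assoc add_left_cancel)
           (simp add: distrib_right add.commute)
    qed
    \<comment> \<open>After multiplication by \<open>\<mu> ^ (2 * i)\<close> the two weights are 2(i
      + 1), from additivity, and 2(i + d), from the torus.\<close>
    have "D a = 0"
    proof (rule distinct_weights)
      show "i + 1 < i + d" "i + d \<le> i + 1 + m" using 3 less.prems by auto
      fix \<mu> assume \<mu>: "of_nat \<mu> \<noteq> (0::'k)"
      let ?b = "of_nat (\<mu> ^ 2) * a"
      have "of_nat (\<mu> ^ (2 * (i + d))) * (of_nat c * \<Phi> a ^ d) = of_nat (\<mu> ^ (2 * i)) * (of_nat c * \<Phi> ?b ^ d)"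
        by (simp only: \<Phi>_of_nat_mult of_nat_mult_power mult.assoc[symmetric] of_nat_mult[symmetric])
           (simp add: power_add distrib_left mult_ac flip: power_mult)
      moreover have "of_nat (\<mu> ^ (2 * (i + d))) * U a (i + d) i = of_nat (\<mu> ^ (2 * i)) * U ?b (i + d) i"
        using less.prems by (intro U_scale \<mu>) auto
      ultimately have "of_nat (\<mu> ^ (2 * (i + d))) * D a = of_nat (\<mu> ^ (2 * i)) * D ?b"
        by (simp only: D_def right_diff_distrib)
      also have "D ?b = of_nat (\<mu> ^ 2) * D a" by (rule D_mult)
      finally show "of_nat (\<mu> ^ (2 * (i + 1))) * D a = of_nat (\<mu> ^ (2 * (i + d))) * D a"
        unfolding of_nat_of_nat_mult by (simp add: power_add distrib_left power2_eq_square mult_ac del: of_nat_mult of_nat_power)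
    qed
    then show ?thesis using U_eq[of a] by (simp add: c_def)
  qed
qed

section \<open>Lower unipotents and Weyl elements\<close>

text \<open>Conjugation by a Weyl element over the prime subfield, whose matrix is known, turns
  \<open>upper (- a)\<close> into \<open>lower a\<close>. It reverses the monomial basis, and the
  signs cancel.\<close>

lemma L_entry:
  assumes "j \<le> m" "i \<le> m"
  shows "L a j i = (if j \<le> i then of_nat (i choose j) * \<Phi> a ^ (i - j) else 0)"
proof -
  let ?w = "mat2 0 1 (- 1) 0 :: 'k^2^2" and ?w' = "mat2 0 (- 1) 1 0 :: 'k^2^2"
  have w_SL2: "?w \<in> SL2 UNIV" "?w' \<in> SL2 UNIV" by (simp_all add: mat2_in_SL2)
  have w: "\<rho> ?w k l = (if k + l = m then (- 1) ^ l else 0)"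
    and w': "\<rho> ?w' k l = (if k + l = m then (- 1) ^ k else 0)" if "k \<le> m" "l \<le> m" for k l
    using that by (simp_all add: \<rho>_prime mat2_in_SL2 prime_subfield_closed uminus_in_prime_subfield
      sym_coeff_antidiagonal s_power s_uminus s_zero s_one add.commute)
  have "lower a = (?w ** upper (- a)) ** ?w'"
    by (simp add: mat2_mult)
  then have "L a j i = (\<Sum>l\<le>m. \<rho> (?w ** upper (- a)) j l * \<rho> ?w' l i)"
    using assms by (simp add: \<rho>_mult w_SL2 upper_in_SL2 SL2_mult_closed)
  also have "\<dots> = \<rho> (?w ** upper (- a)) j (m - i) * \<rho> ?w' (m - i) i"
    using assms by (intro sum_eq_single) (auto simp: w')
  also have "\<rho> (?w ** upper (- a)) j (m - i) = (\<Sum>l\<le>m. \<rho> ?w j l * U (- a) l (m - i))"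
    using assms by (simp add: \<rho>_mult w_SL2 upper_in_SL2)
  also have "\<dots> = \<rho> ?w j (m - j) * U (- a) (m - j) (m - i)"
    using assms by (intro sum_eq_single) (auto simp: w)
  finally have *: "L a j i = (- 1) ^ (m - j) * U (- a) (m - j) (m - i) * (- 1) ^ (m - i)"
    using assms by (simp add: w w')
  show ?thesis
  proof (cases "j \<le> i")
    case True
    define d where "d = i - j"
    have d: "m - j = (m - i) + d" "i - j = d" "m - (m - i) = i" "i choose d = i choose j"
      using True assms binomial_symmetric[of j i] by (auto simp: d_def)
    have "U (- a) ((m - i) + d) (m - i) = of_nat (i choose j) * ((- 1) ^ d * \<Phi> a ^ d)"
      using U_band[of "m - i" d "- a"] d assms True by (simp add: \<Phi>_uminus power_minus[of "\<Phi> a"])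
    then have L: "L a j i = (- 1) ^ (m - i) * ((- 1) ^ d * (of_nat (i choose j) * ((- 1) ^ d * \<Phi> a ^ d))) * (- 1) ^ (m - i)"
      by (simp only: * d(1) power_add mult.assoc)
    have sign: "(- 1) ^ k * x * (- 1) ^ k = x" "(- 1) ^ k * (x * ((- 1) ^ k * y)) = x * y" for k and x y :: 'r
      by (cases "even k"; simp)+
    have "L a j i = of_nat (i choose j) * \<Phi> a ^ d"
      unfolding L sign ..
    then show ?thesis using True d(2) by simp
  next
    case False
    then show ?thesis using assms by (simp add: * U_below)
  qed
qed

text \<open>Since \<open>weyl a\<close> inverts the torus, multiplying it by
  \<open>torus \<mu>\<close> on both sides does not change it. So the entry has both the weights 2(i
  + j) and 2m.\<close>

lemma W_entry_zero:
  assumes "a \<noteq> 0" "j \<le> m" "i \<le> m" "i + j \<noteq> m"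
  shows "W a j i = 0"
proof -
  have *: "of_nat (\<mu> ^ (2 * (i + j))) * W a j i = of_nat (\<mu> ^ (2 * m)) * W a j i"
    if \<mu>: "of_nat \<mu> \<noteq> (0::'k)" for \<mu>
  proof -
    have SL2: "weyl a ** torus \<mu> \<in> SL2 UNIV"
      using assms(1) \<mu> by (intro SL2_mult_closed) (simp_all add: mat2_in_SL2)
    have "torus \<mu> ** (weyl a ** torus \<mu>) = weyl a"
      using \<mu> by (simp add: mat2_mult mult.left_commute[of _ a] mult.left_commute[of _ "inverse a"])
    then have "of_nat (\<mu> ^ m) * W a j i = of_nat (\<mu> ^ (2 * j)) * \<rho> (weyl a ** torus \<mu>) j i"
      using torus_mult_left[OF \<mu> SL2 assms(2,3)] by simp
    then have "of_nat (\<mu> ^ m) * (of_nat (\<mu> ^ m) * W a j i)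
        = of_nat (\<mu> ^ (2 * j)) * (of_nat (\<mu> ^ m) * \<rho> (weyl a ** torus \<mu>) j i)"
      by (simp only: mult.assoc[symmetric] of_nat_mult[symmetric] mult.commute)
    also have "\<dots> = of_nat (\<mu> ^ (2 * j)) * (of_nat (\<mu> ^ (2 * i)) * W a j i)"
      using torus_mult_right[OF \<mu> weyl_in_SL2[OF assms(1)] assms(2,3)] by (simp only:)
    finally show ?thesis
      by (simp only: mult.assoc[symmetric] of_nat_mult[symmetric] power_add[symmetric])
         (simp add: mult_2 mult_2_right algebra_simps)
  qed
  show ?thesis
  proof (cases "i + j < m")
    case True
    then show ?thesis using * by (intro distinct_weights[of "i + j" m]) auto
  next
    case False
    then show ?thesis using * assms by (intro distinct_weights[of m "i + j"]) (auto simp del: of_nat_power)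
  qed
qed

text \<open>Column 0 of the identity \<open>lower (1/a) ** weyl a = upper a ** lower (- 1/a)\<close>.\<close>

lemma \<Phi>_inverse_W:
  assumes "a \<noteq> 0" "j \<le> m"
  shows "\<Phi> (inverse a) ^ (m - j) * W a m 0 = \<Phi> a ^ j"
proof -
  have SL2: "weyl a \<in> SL2 UNIV" using assms(1) by (rule weyl_in_SL2)
  have "lower (inverse a) ** weyl a = upper a ** lower (- inverse a)"
    using assms(1) by (simp add: mat2_mult)
  moreover have "\<rho> (lower (inverse a) ** weyl a) j 0 = L (inverse a) j m * W a m 0"
    using assms by (subst \<rho>_mult[OF lower_in_SL2 SL2]; (intro sum_eq_single)?) (auto simp: W_entry_zero)
  moreover have "\<rho> (upper a ** lower (- inverse a)) j 0 = U a j 0 * L (- inverse a) 0 0"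
    using assms by (subst \<rho>_mult[OF upper_in_SL2 lower_in_SL2]; (intro sum_eq_single)?) (auto simp: L_entry)
  ultimately have "of_nat (m choose j) * (\<Phi> (inverse a) ^ (m - j) * W a m 0) = of_nat (m choose j) * \<Phi> a ^ j"
    using U_band[of 0 j a] assms by (simp add: L_entry mult.assoc)
  then show ?thesis using of_nat_cancel of_nat_binomial_neq_0 assms by blast
qed

text \<open>For \<open>j = m\<close> the factor \<open>\<Phi> (inverse a)\<close> has exponent
  0.\<close>

lemma W_corner: "a \<noteq> 0 \<Longrightarrow> W a m 0 = \<Phi> a ^ m"
  using \<Phi>_inverse_W[of a m] by simp

text \<open>Write x and y for the two values. Row 0 for \<open>inverse a\<close> gives x^m y^m = 1,
  row m - 1 for \<open>a\<close> gives y x^m = x^(m-1). Multiplying the latter by y^m on the right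
  yields y = x^(m-1) y^m, with no use of commutativity.\<close>

lemma \<Phi>_inverse:
  assumes "a \<noteq> 0"
  shows "\<Phi> a * \<Phi> (inverse a) = 1"
proof -
  define k where "k = m - 1"
  have k: "Suc k = m" "m - k = 1" "k \<le> m" using m_pos by (auto simp: k_def)
  let ?x = "\<Phi> a" and ?y = "\<Phi> (inverse a)"
  have inv: "?x ^ m * ?y ^ m = 1"
    using \<Phi>_inverse_W[of "inverse a" 0] W_corner[of "inverse a"] assms by simp
  have "?y * ?x ^ m = ?x ^ k"
    using \<Phi>_inverse_W[OF assms k(3)] W_corner[OF assms] by (simp add: k(2))
  then have "?y * (?x ^ m * ?y ^ m) = ?x ^ k * ?y ^ m"
    by (simp add: mult.assoc[symmetric])
  then have "?y = ?x ^ k * ?y ^ m" by (simp add: inv)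
  then have "?x * ?y = ?x ^ m * ?y ^ m" by (metis k(1) mult.assoc power_Suc)
  with inv show ?thesis by simp
qed

text \<open>The diagonal matrix of c and 1/c is \<open>weyl c\<close> times a Weyl element over the
  prime subfield, so its last entry is \<open>\<Phi> c ^ m\<close>; diagonal matrices multiply
  entrywise. This serves commutativity for \<open>m = 1\<close>.\<close>

lemma \<Phi>_power_mult:
  assumes "a \<noteq> 0" "b \<noteq> 0"
  shows "\<Phi> (a * b) ^ m = \<Phi> a ^ m * \<Phi> b ^ m"
proof -
  let ?w' = "mat2 0 (- 1) 1 0 :: 'k^2^2"
  have w': "\<rho> ?w' 0 l = (if l = m then 1 else 0)" if "l \<le> m" for l
    using that by (simp_all add: \<rho>_prime mat2_in_SL2 prime_subfield_closed uminus_in_prime_subfield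
      sym_coeff_antidiagonal s_zero s_one)
  have *: "\<rho> (mat2 c 0 0 (inverse c)) m l = (if l = m then \<Phi> c ^ m else 0)" if "c \<noteq> 0" "l \<le> m" for c l
  proof -
    have "mat2 c 0 0 (inverse c) = weyl c ** ?w'" by (simp add: mat2_mult)
    then have "\<rho> (mat2 c 0 0 (inverse c)) m l = (\<Sum>k\<le>m. W c m k * \<rho> ?w' k l)"
      using that by (simp add: \<rho>_mult weyl_in_SL2 mat2_in_SL2)
    also have "\<dots> = W c m 0 * \<rho> ?w' 0 l"
      using that by (intro sum_eq_single) (auto simp: W_entry_zero)
    finally show ?thesis using that by (simp add: w' W_corner)
  qed
  have "mat2 (a * b) 0 0 (inverse (a * b)) = mat2 a 0 0 (inverse a) ** mat2 b 0 0 (inverse b)"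
    using assms by (simp add: mat2_mult)
  then have "\<rho> (mat2 (a * b) 0 0 (inverse (a * b))) m m
      = (\<Sum>l\<le>m. \<rho> (mat2 a 0 0 (inverse a)) m l * \<rho> (mat2 b 0 0 (inverse b)) l m)"
    using assms by (simp add: \<rho>_mult mat2_in_SL2)
  also have "\<dots> = \<rho> (mat2 a 0 0 (inverse a)) m m * \<rho> (mat2 b 0 0 (inverse b)) m m"
    using assms by (intro sum_eq_single) (auto simp: *)
  finally show ?thesis
    using assms *[of a m] *[of b m] *[of "a * b" m] by simp
qed

section \<open>\<Phi> is a ring homomorphism\<close>

text \<open>For \<open>m = 1\<close> this is \<open>a * b = b * a\<close> under the multiplicativity
  just shown. For larger \<open>m\<close> the second subdiagonal of two commuting unipotents gives
  it up to the invertible factor 2.\<close>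

lemma \<Phi>_commute: "\<Phi> a * \<Phi> b = \<Phi> b * \<Phi> a"
proof (cases "m = 1")
  case True
  show ?thesis
  proof (cases "a = 0 \<or> b = 0")
    case True
    then show ?thesis by (auto simp: \<Phi>_0)
  next
    case False
    then show ?thesis
      using \<Phi>_power_mult[of a b] \<Phi>_power_mult[of b a] True by (simp add: mult.commute)
  qed
next
  case False
  define k where "k = m - 2"
  have k: "m = k + 2" using False m_pos by (simp add: k_def)
  have "U (a + b) (k + 2) k = U (b + a) (k + 2) k" by (simp add: add.commute)
  then have "U a (k + 2) (k + 1) * U b (k + 1) k = U b (k + 2) (k + 1) * U a (k + 1) k"
    by (subst (asm) (1 2) U_add_band) (simp_all add: U_diagonal k numeral_2_eq_2)
  then have "of_nat 2 * (\<Phi> a * \<Phi> b) = of_nat 2 * (\<Phi> b * \<Phi> a)"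
    using U_superdiagonal[of k] U_superdiagonal[of "k + 1"] k
    by (simp add: mult_of_nat_left_commute del: of_nat_numeral)
  moreover have "of_nat 2 \<noteq> (0::'k)" using m_pos by (intro of_nat_neq_0) auto
  ultimately show ?thesis using of_nat_cancel by blast
qed

text \<open>Additivity applied to \<open>1/a - 1/(a + 1) = 1/(a (a + 1))\<close>.\<close>

lemma \<Phi>_square: "\<Phi> (a * a) = \<Phi> a * \<Phi> a"
proof (cases "a = 0 \<or> a + 1 = 0")
  case True
  then have "a = 0 \<or> a = - 1" by (auto simp: eq_neg_iff_add_eq_0)
  then show ?thesis by (auto simp: \<Phi>_0 \<Phi>_1 \<Phi>_uminus)
next
  case False
  define x y where "x = \<Phi> a" and "y = \<Phi> (a + 1)"
  define x' y' where "x' = \<Phi> (inverse a)" and "y' = \<Phi> (inverse (a + 1))"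
  have "inverse (a * (a + 1)) = inverse a - inverse (a + 1)"
    using False by (simp add: field_simps)
  then have z: "\<Phi> (inverse (a * (a + 1))) = x' - y'" by (simp add: \<Phi>_diff x'_def y'_def)
  have inv: "x * x' = 1" "y * y' = 1"
    using False by (simp_all add: \<Phi>_inverse x_def x'_def y_def y'_def)
  have inv': "(x' - y') * \<Phi> (a * (a + 1)) = 1"
    using False \<Phi>_inverse[of "a * (a + 1)"] unfolding z[symmetric]
    by (subst \<Phi>_commute) (simp only: mult_eq_0_iff simp_thms)
  have y: "y = x + 1" by (simp add: y_def x_def \<Phi>_add \<Phi>_1)
  \<comment> \<open>As \<open>y = x + 1\<close> commutes with \<open>x\<close>, the product
    \<open>y * x\<close> is a left inverse of \<open>x' - y'\<close>. It therefore equals the right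
    inverse \<open>\<Phi> (a * (a + 1))\<close>.\<close>
  have "y * x * (x' - y') = y * (x * x') - x * (y * y')"
    by (simp add: y algebra_simps)
  then have "y * x * (x' - y') = 1" by (simp add: inv, simp add: y)
  then have "\<Phi> (a * (a + 1)) = y * x * ((x' - y') * \<Phi> (a * (a + 1)))"
    by (simp only: mult.assoc[symmetric] mult_1_left)
  also have "\<dots> = x * x + x" by (simp only: inv' mult_1_right) (simp add: y distrib_right)
  finally show ?thesis by (simp add: \<Phi>_add x_def distrib_left)
qed

text \<open>Polarise the square of \<open>a + b\<close>; 2 is invertible.\<close>

lemma \<Phi>_mult: "\<Phi> (a * b) = \<Phi> a * \<Phi> b"
proof -
  have "\<Phi> ((a + b) * (a + b)) = (\<Phi> a + \<Phi> b) * (\<Phi> a + \<Phi> b)"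
    by (simp only: \<Phi>_square \<Phi>_add)
  then have "\<Phi> (of_nat 2 * (a * b)) = of_nat 2 * (\<Phi> a * \<Phi> b)"
    by (simp add: algebra_simps \<Phi>_add \<Phi>_square \<Phi>_commute[of b a] mult_2[symmetric])
  then have "of_nat 2 * \<Phi> (a * b) = of_nat 2 * (\<Phi> a * \<Phi> b)"
    by (simp only: \<Phi>_of_nat_mult)
  moreover have "of_nat 2 \<noteq> (0::'k)" using m_pos by (intro of_nat_neq_0) auto
  ultimately show ?thesis using of_nat_cancel by blast
qed

lemma \<Phi>_power: "\<Phi> (a ^ d) = \<Phi> a ^ d"
  by (induction d) (simp_all add: \<Phi>_1 \<Phi>_mult)

text \<open>Both sides are multiplicative in \<open>g\<close>, because \<Phi> is a ring
  homomorphism, and they agree on the generating unipotents.\<close>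

theorem \<rho>_eq_\<Phi>_sym_coeff:
  assumes "g \<in> SL2 UNIV" "j \<le> m" "i \<le> m"
  shows "\<rho> g j i = \<Phi> (sym_coeff m g j i)"
  using assms
proof (induction g arbitrary: i j rule: SL2_induct)
  case (upper a)
  then show ?case
    using U_band[of i "j - i" a]
    by (auto simp: sym_coeff_upper U_below \<Phi>_0 \<Phi>_mult \<Phi>_of_nat \<Phi>_power)
next
  case (lower a)
  then show ?case
    by (simp add: L_entry sym_coeff_lower \<Phi>_0 \<Phi>_mult \<Phi>_of_nat \<Phi>_power)
next
  case (mult g h)
  then show ?case
    by (simp add: \<rho>_mult sym_coeff_mult \<Phi>_sum \<Phi>_mult)
qed

end

section \<open>The vector space structure\<close>

text \<open>The ring \<open>End(V) \<times> K\<close>; the factor \<open>K\<close> only serves to have \<open>0 \<noteq> 1\<close>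
  when \<open>V\<close> is trivial.\<close>

typedef (overloaded) ('v, 'k) endo =
  "{f :: ('v::ab_group_add \<Rightarrow> 'v) \<times> 'k::field. Modules.additive (fst f)}"
  by (intro exI[of _ "(\<lambda>_. 0, 0)"]) (simp add: Modules.additive_def)

setup_lifting type_definition_endo

lift_definition app :: "('v::ab_group_add, 'k::field) endo \<Rightarrow> 'v \<Rightarrow> 'v" is fst .
lift_definition scal :: "('v::ab_group_add, 'k::field) endo \<Rightarrow> 'k" is snd .

lemma endo_eqI: "(\<And>v. app e v = app e' v) \<Longrightarrow> scal e = scal e' \<Longrightarrow> e = e'"
  by transfer (auto simp: prod_eq_iff)

lemma additive_app: "Modules.additive (app e)"
  by transfer simp

definition mk_endo :: "('v::ab_group_add \<Rightarrow> 'v) \<Rightarrow> 'k::field \<Rightarrow> ('v, 'k) endo" where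
  "mk_endo f c = Abs_endo (f, c)"

lemma app_mk_endo: "Modules.additive f \<Longrightarrow> app (mk_endo f c) = f"
  and scal_mk_endo: "Modules.additive f \<Longrightarrow> scal (mk_endo f c) = c"
  by (simp_all add: mk_endo_def app.rep_eq scal.rep_eq Abs_endo_inverse)

instantiation endo :: (ab_group_add, field) ring_1
begin

lift_definition zero_endo :: "('a, 'b) endo" is "(\<lambda>_. 0, 0)"
  by (simp add: Modules.additive_def)
lift_definition one_endo :: "('a, 'b) endo" is "(\<lambda>v. v, 1)"
  by (simp add: Modules.additive_def)
lift_definition plus_endo :: "('a, 'b) endo \<Rightarrow> ('a, 'b) endo \<Rightarrow> ('a, 'b) endo"
  is "\<lambda>e e'. (\<lambda>v. fst e v + fst e' v, snd e + snd e')"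
  by (simp add: Modules.additive_def)
lift_definition minus_endo :: "('a, 'b) endo \<Rightarrow> ('a, 'b) endo \<Rightarrow> ('a, 'b) endo"
  is "\<lambda>e e'. (\<lambda>v. fst e v - fst e' v, snd e - snd e')"
  by (simp add: Modules.additive_def)
lift_definition uminus_endo :: "('a, 'b) endo \<Rightarrow> ('a, 'b) endo"
  is "\<lambda>e. (\<lambda>v. - fst e v, - snd e)"
  by (simp add: Modules.additive_def)
lift_definition times_endo :: "('a, 'b) endo \<Rightarrow> ('a, 'b) endo \<Rightarrow> ('a, 'b) endo"
  is "\<lambda>e e'. (\<lambda>v. fst e (fst e' v), snd e * snd e')"
  by (simp add: Modules.additive_def)

instance
  by standard (transfer; auto simp: Modules.additive_def algebra_simps Modules.additive.zero[unfolded Modules.additive_def] prod_eq_iff)+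

end

lemma app_simps:
  "app 0 v = 0" "app 1 v = v" "app (e + e') v = app e v + app e' v" "app (e * e') v = app e (app e' v)"
  and scal_simps:
  "scal 0 = 0" "scal 1 = 1" "scal (e + e') = scal e + scal e'" "scal (e * e') = scal e * scal e'"
  by (transfer; simp)+

lemma app_sum: "app (sum f A) v = (\<Sum>a\<in>A. app (f a) v)"
  and scal_sum: "scal (sum f A) = (\<Sum>a\<in>A. scal (f a))"
  by (induction A rule: infinite_finite_induct) (simp_all add: app_simps scal_simps)

lemma poly_over_prime_subfield_mult:
  fixes p q :: "'k::field poly"
  assumes "\<And>j. coeff p j \<in> prime_subfield" "\<And>j. coeff q j \<in> prime_subfield"
  shows "coeff (p * q) j \<in> prime_subfield"
  unfolding coeff_mult by (intro sum_in_prime_subfield prime_subfield_closed assms)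

lemma poly_over_prime_subfield_power:
  fixes p :: "'k::field poly"
  assumes "\<And>j. coeff p j \<in> prime_subfield"
  shows "coeff (p ^ d) j \<in> prime_subfield"
proof (induction d arbitrary: j)
  case 0
  show ?case by (simp add: prime_subfield_closed)
next
  case (Suc d)
  show ?case unfolding power_Suc by (intro poly_over_prime_subfield_mult assms Suc.IH)
qed

lemma sym_coeff_in_prime_subfield:
  assumes "g \<in> SL2 prime_subfield" "i \<le> m"
  shows "sym_coeff m g j i \<in> prime_subfield"
proof -
  have "coeff [:a, b:] k \<in> prime_subfield" if "a \<in> prime_subfield" "b \<in> prime_subfield" for a b :: 'a and k
    using that by (auto simp: coeff_pCons prime_subfield_closed split: nat.splits)
  with assms show ?thesis
    by (simp add: sym_coeff_def sym_act_monom SL2_def poly_over_prime_subfield_mult poly_over_prime_subfield_power)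
qed

section \<open>Blocks of the action on V\<close>

locale sl2_sym_module =
  fixes m :: nat
    and act :: "'k::field^2^2 \<Rightarrow> 'v::ab_group_add \<Rightarrow> 'v"
    and smul1 :: "'k \<Rightarrow> 'v \<Rightarrow> 'v"
    and I :: "'i set"
    and \<phi> :: "'v \<Rightarrow> 'i \<Rightarrow> 'k poly"
  assumes m_pos: "0 < m"
    and char: "CHAR('k) = 0 \<or> 2 * m + 1 < CHAR('k)"
    and module: "is_G_module act"
    and vs: "is_vs_over prime_subfield smul1"
    and iso: "is_sym_iso prime_subfield m smul1 act I \<phi>"
begin

lemma bij_\<phi>: "bij_betw \<phi> UNIV (dsum_sym prime_subfield m I)"
  and \<phi>_add: "\<phi> (u + v) = (\<lambda>x. \<phi> u x + \<phi> v x)"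
  and \<phi>_smul1: "c \<in> prime_subfield \<Longrightarrow> \<phi> (smul1 c v) = (\<lambda>x. smult c (\<phi> v x))"
  and \<phi>_act: "g \<in> SL2 prime_subfield \<Longrightarrow> \<phi> (act g v) = (\<lambda>x. sym_act m g (\<phi> v x))"
  using iso unfolding is_sym_iso_def by blast+

lemma \<phi>_eqD: "\<phi> u = \<phi> v \<Longrightarrow> u = v"
  using bij_\<phi> by (auto simp: bij_betw_def inj_def)

lemma \<phi>_in: "\<phi> v \<in> dsum_sym prime_subfield m I"
  using bij_\<phi> by (auto simp: bij_betw_def)

lemma degree_\<phi>: "degree (\<phi> v x) \<le> m"
  and coeff_\<phi>: "coeff (\<phi> v x) j \<in> prime_subfield"
  using \<phi>_in[of v] by (cases "x \<in> I"; auto simp: dsum_sym_def prime_subfield_closed)+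

lemma \<phi>_zero: "\<phi> 0 = (\<lambda>x. 0)"
proof
  show "\<phi> 0 x = 0" for x
    using fun_cong[OF \<phi>_add[of 0 0], of x] unfolding add_0_left by (simp only: add_cancel_right_right)
qed

lemma \<phi>_sum: "\<phi> (sum f A) = (\<lambda>x. \<Sum>a\<in>A. \<phi> (f a) x)"
  by (induction A rule: infinite_finite_induct) (simp_all add: \<phi>_zero \<phi>_add)

lemma additive_act: "g \<in> SL2 UNIV \<Longrightarrow> Modules.additive (act g)"
  and act_mult: "g \<in> SL2 UNIV \<Longrightarrow> h \<in> SL2 UNIV \<Longrightarrow> act (g ** h) v = act g (act h v)"
  using module unfolding is_G_module_def Modules.additive_def by blast+

lemma additive_smul1: "c \<in> prime_subfield \<Longrightarrow> Modules.additive (smul1 c)"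
  using vs unfolding is_vs_over_def Modules.additive_def by blast

text \<open>The matrix unit \<open>E\<^sub>j\<^sub>i\<close> acting on \<open>V = Sym \<otimes> M\<close>: the coefficient of \<open>t^i\<close> is moved to \<open>t^j\<close>.\<close>

definition P :: "nat \<Rightarrow> nat \<Rightarrow> 'v \<Rightarrow> 'v" where
  "P j i v = inv_into UNIV \<phi> (\<lambda>x. monom (coeff (\<phi> v x) i) j)"

lemma \<phi>_P:
  assumes "j \<le> m"
  shows "\<phi> (P j i v) = (\<lambda>x. monom (coeff (\<phi> v x) i) j)"
proof -
  have "finite {x. monom (coeff (\<phi> v x) i) j \<noteq> 0}"
    by (rule finite_subset[of _ "{x. \<phi> v x \<noteq> 0}"]) (use \<phi>_in[of v] in \<open>auto simp: dsum_sym_def\<close>)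
  then have "(\<lambda>x. monom (coeff (\<phi> v x) i) j) \<in> dsum_sym prime_subfield m I"
    using \<phi>_in[of v] assms
    by (auto simp: dsum_sym_def coeff_\<phi> prime_subfield_closed intro: order_trans[OF degree_monom_le])
  then have "(\<lambda>x. monom (coeff (\<phi> v x) i) j) \<in> \<phi> ` UNIV"
    using bij_\<phi> by (simp add: bij_betw_def)
  then show ?thesis
    unfolding P_def by (rule f_inv_into_f)
qed

lemma additive_P: "j \<le> m \<Longrightarrow> Modules.additive (P j i)"
  by (intro Modules.additive.intro \<phi>_eqD) (simp add: \<phi>_P \<phi>_add add_monom)

lemma P_P: "k \<le> m \<Longrightarrow> j' \<le> m \<Longrightarrow> P k j (P j' i v) = (if j = j' then P k i v else 0)"
  by (intro \<phi>_eqD) (auto simp: \<phi>_P \<phi>_zero)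

lemma P_sum: "(\<Sum>k\<le>m. P k k v) = v"
  by (intro \<phi>_eqD) (simp add: \<phi>_sum \<phi>_P degree_\<phi> flip: poly_eq_sum_monom)

text \<open>For V = Sym tensored with M, this is the block of \<open>f\<close> in row
  \<open>j\<close> and column \<open>i\<close>, acting on all of V as 1 tensored with that
  endomorphism of M. Blocks thus live on V itself, and M needs no type of its own.\<close>

definition ent :: "nat \<Rightarrow> nat \<Rightarrow> ('v \<Rightarrow> 'v) \<Rightarrow> 'v \<Rightarrow> 'v" where
  "ent j i f v = (\<Sum>k\<le>m. P k j (f (P i k v)))"

lemma additive_ent: "Modules.additive f \<Longrightarrow> i \<le> m \<Longrightarrow> Modules.additive (ent j i f)"
  by (simp add: Modules.additive_def ent_def additive_P[unfolded Modules.additive_def] sum.distrib)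

text \<open>Blocks multiply like matrices: insert the identity, as the sum of the
  \<open>P l l\<close>, between \<open>f\<close> and \<open>g\<close>.\<close>

lemma ent_compose:
  assumes "Modules.additive f" "i \<le> m"
  shows "ent j i (\<lambda>v. f (g v)) v = (\<Sum>l\<le>m. ent j l f (ent l i g v))"
proof -
  have *: "P l k (ent l i g v) = P l l (g (P i k v))" if "l \<le> m" "k \<le> m" for l k
  proof -
    have "P l k (ent l i g v) = (\<Sum>k'\<le>m. P l k (P k' l (g (P i k' v))))"
      unfolding ent_def using that by (intro Modules.additive.sum additive_P)
    also have "\<dots> = P l l (g (P i k v))"
      using that by (simp add: P_P if_distrib cong: if_cong)
    finally show ?thesis .
  qed
  have "(\<Sum>l\<le>m. ent j l f (ent l i g v)) = (\<Sum>l\<le>m. \<Sum>k\<le>m. P k j (f (P l l (g (P i k v)))))"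
    by (simp add: ent_def[of j] *)
  also have "\<dots> = (\<Sum>k\<le>m. \<Sum>l\<le>m. P k j (f (P l l (g (P i k v)))))"
    by (rule sum.swap)
  also have "\<dots> = (\<Sum>k\<le>m. P k j (f (\<Sum>l\<le>m. P l l (g (P i k v)))))"
    using assms by (intro sum.cong refl) (simp add: Modules.additive.sum[OF additive_P] Modules.additive.sum[OF assms(1)])
  finally show ?thesis by (simp add: P_sum ent_def)
qed

lemma ent_prime:
  assumes "g \<in> SL2 prime_subfield" "j \<le> m" "i \<le> m"
  shows "ent j i (act g) v = smul1 (sym_coeff m g j i) v"
proof (rule \<phi>_eqD, rule ext)
  fix x
  have *: "sym_act m g (monom (coeff q k) i) = smult (coeff q k) (sym_act m g (monom 1 i))" for q k
    by (simp add: smult_monom flip: sym_act_smult)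
  have "sym_coeff m g j i \<in> prime_subfield"
    by (rule sym_coeff_in_prime_subfield) fact+
  then have "\<phi> (smul1 (sym_coeff m g j i) v) x = smult (sym_coeff m g j i) (\<Sum>k\<le>m. monom (coeff (\<phi> v x) k) k)"
    by (simp add: \<phi>_smul1 degree_\<phi> flip: poly_eq_sum_monom)
  then show "\<phi> (ent j i (act g) v) x = \<phi> (smul1 (sym_coeff m g j i) v) x"
    using assms by (simp add: * ent_def \<phi>_sum \<phi>_P \<phi>_act sym_coeff_def smult_sum_right smult_monom mult.commute)
qed

text \<open>Endomorphisms 1 tensored with h commute with matrix units. The new scalars are blocks of
  this kind, so they commute with \<open>P\<close> as well.\<close>

lemma P_ent:
  assumes "Modules.additive f" "j \<le> m" "i \<le> m" "a \<le> m" "b \<le> m"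
  shows "P a b (ent j i f v) = ent j i f (P a b v)"
proof -
  have "P a b (ent j i f v) = (\<Sum>k\<le>m. P a b (P k j (f (P i k v))))"
    unfolding ent_def using assms by (intro Modules.additive.sum additive_P)
  also have "\<dots> = P a j (f (P i b v))"
    using assms by (simp add: P_P if_distrib cong: if_cong)
  also have "\<dots> = (\<Sum>k\<le>m. if k = a then P k j (f (P i b v)) else 0)"
    using assms by simp
  also have "\<dots> = ent j i f (P a b v)"
    unfolding ent_def using assms
    by (intro sum.cong refl) (auto simp: P_P Modules.additive.zero[OF assms(1)] Modules.additive.zero[OF additive_P])
  finally show ?thesis .
qed

text \<open>\<open>P 0 i\<close> reads off the i-th coordinate and stores it in degree 0. In these
  coordinates \<open>f\<close> acts through its matrix of blocks.\<close>

lemma P_apply: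
  assumes "Modules.additive f" "j \<le> m"
  shows "P 0 j (f v) = (\<Sum>i\<le>m. ent j i f (P 0 i v))"
proof -
  have "ent j i f (P 0 i v) = P 0 j (f (P i i v))" if "i \<le> m" for i
  proof -
    have "ent j i f (P 0 i v) = (\<Sum>k\<le>m. if k = 0 then P k j (f (P i i v)) else 0)"
      unfolding ent_def using assms that
      by (intro sum.cong refl) (auto simp: P_P Modules.additive.zero[OF assms(1)] Modules.additive.zero[OF additive_P])
    then show ?thesis by simp
  qed
  then have "(\<Sum>i\<le>m. ent j i f (P 0 i v)) = P 0 j (f (\<Sum>i\<le>m. P i i v))"
    by (simp add: Modules.additive.sum[OF additive_P] Modules.additive.sum[OF assms(1)])
  then show ?thesis by (simp add: P_sum)
qed

text \<open>The second component repeats the ordinary symmetric power over K, so that the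
  representation axioms hold in both factors of the ring.\<close>

definition \<rho> :: "'k^2^2 \<Rightarrow> nat \<Rightarrow> nat \<Rightarrow> ('v, 'k) endo" where
  "\<rho> g j i = mk_endo (ent j i (act g)) (sym_coeff m g j i)"

sublocale sl2_matrix_rep m "\<lambda>c. mk_endo (smul1 c) c" \<rho>
proof
  fix x y :: 'k assume xy: "x \<in> prime_subfield" "y \<in> prime_subfield"
  note [simp] = app_mk_endo scal_mk_endo additive_smul1 prime_subfield_closed app_simps scal_simps
  show "mk_endo (smul1 (x + y)) (x + y) = mk_endo (smul1 x) x + mk_endo (smul1 y) y"
    "mk_endo (smul1 (x * y)) (x * y) = mk_endo (smul1 x) x * mk_endo (smul1 y) y"
    using vs xy by (auto intro!: endo_eqI simp: is_vs_over_def)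
next
  show "mk_endo (smul1 1) 1 = 1"
    using vs by (auto intro!: endo_eqI simp: is_vs_over_def app_mk_endo scal_mk_endo additive_smul1
      prime_subfield_closed app_simps scal_simps)
next
  fix g h :: "'k^2^2" and j i
  assume *: "g \<in> SL2 UNIV" "h \<in> SL2 UNIV" "j \<le> m" "i \<le> m"
  have "ent j i (act (g ** h)) v = ent j i (\<lambda>v. act g (act h v)) v" for v
    using * by (simp add: ent_def act_mult)
  then have "ent j i (act (g ** h)) v = (\<Sum>l\<le>m. ent j l (act g) (ent l i (act h) v))" for v
    using * by (simp only: ent_compose additive_act)
  with * show "\<rho> (g ** h) j i = (\<Sum>l\<le>m. \<rho> g j l * \<rho> h l i)"
    by (intro endo_eqI) (simp_all add: \<rho>_def app_mk_endo scal_mk_endo additive_ent additive_act SL2_mult_closed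
      app_sum scal_sum app_simps scal_simps sym_coeff_mult)
next
  fix g :: "'k^2^2" and j i
  assume "g \<in> SL2 prime_subfield" "j \<le> m" "i \<le> m"
  then have "ent j i (act g) = smul1 (sym_coeff m g j i)" by (intro ext ent_prime)
  then show "\<rho> g j i = mk_endo (smul1 (sym_coeff m g j i)) (sym_coeff m g j i)"
    by (simp only: \<rho>_def)
qed (fact m_pos char)+

section \<open>Scalar multiplication and decomposition over K\<close>

definition smul :: "'k \<Rightarrow> 'v \<Rightarrow> 'v" where "smul c = app (\<Phi> c)"

lemma smul_add: "smul c (u + v) = smul c u + smul c v"
  by (simp add: smul_def Modules.additive.add[OF additive_app])

lemma smul_add_left: "smul (c + d) v = smul c v + smul d v"
  by (simp add: smul_def \<Phi>_add app_simps)

lemma smul_mult: "smul (c * d) v = smul c (smul d v)"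
  by (simp add: smul_def \<Phi>_mult app_simps)

lemma smul_one: "smul 1 v = v"
  by (simp add: smul_def \<Phi>_1 app_simps)

lemma is_vs_over_smul: "is_vs_over UNIV smul"
  by (simp add: is_vs_over_def smul_add smul_add_left smul_mult smul_one)

lemma smul_eq_smul1: "c \<in> prime_subfield \<Longrightarrow> smul c v = smul1 c v"
  by (simp add: smul_def \<Phi>_prime app_mk_endo additive_smul1)

lemma ent_act:
  assumes "g \<in> SL2 UNIV" "j \<le> m" "i \<le> m"
  shows "ent j i (act g) v = smul (sym_coeff m g j i) v"
  using arg_cong[OF \<rho>_eq_\<Phi>_sym_coeff[OF assms], of "\<lambda>e. app e v"] assms
  by (simp add: smul_def \<rho>_def app_mk_endo additive_ent additive_act)

lemma P_smul: "a \<le> m \<Longrightarrow> b \<le> m \<Longrightarrow> P a b (smul c v) = smul c (P a b v)"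
  unfolding smul_def \<Phi>_def \<rho>_def
  by (simp add: app_mk_endo additive_ent additive_act upper_in_SL2 P_ent)

lemma P_act:
  "g \<in> SL2 UNIV \<Longrightarrow> j \<le> m \<Longrightarrow> P 0 j (act g v) = (\<Sum>i\<le>m. smul (sym_coeff m g j i) (P 0 i v))"
  by (simp add: P_apply additive_act ent_act)

sublocale V: vector_space smul
  by unfold_locales (simp_all add: smul_add smul_add_left smul_mult smul_one)

text \<open>\<open>range (P 0 0)\<close> is the multiplicity space of \<open>Sym\<close> in \<open>V\<close>; its \<open>K\<close>-bases index the summands.\<close>

lemma sym_decomposition: "\<exists>J \<psi>. is_sym_iso UNIV m smul act (J :: 'v set) (\<psi> :: 'v \<Rightarrow> 'v \<Rightarrow> 'k poly)"
proof -
  obtain B where B: "B \<subseteq> range (P 0 0)" "V.independent B" "range (P 0 0) \<subseteq> V.span B"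
    by (rule V.maximal_independent_subset)
  define R where "R = V.representation B"
  have "P 0 i v = P 0 0 (P 0 i v)" for i v by (simp add: P_P)
  then have span: "P 0 i v \<in> V.span B" for i v using B(3) by (metis rangeI subsetD)
  \<comment> \<open>The coefficient of t^i in the summand of \<open>b\<close> is the
    \<open>b\<close>-coordinate of the i-th coordinate of \<open>v\<close>.\<close>
  define \<psi> where "\<psi> v b = (\<Sum>i\<le>m. monom (R (P 0 i v) b) i)" for v b
  have coeff_\<psi>: "coeff (\<psi> v b) j = (if j \<le> m then R (P 0 j v) b else 0)" for v b j
    by (simp add: \<psi>_def coeff_sum)
  have degree_\<psi>: "degree (\<psi> v b) \<le> m" for v b
    by (rule degree_le) (simp add: coeff_\<psi>)
  have \<psi>_in: "\<psi> v \<in> dsum_sym UNIV m B" for v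
  proof -
    have "{b. \<psi> v b \<noteq> 0} \<subseteq> (\<Union>i\<le>m. {b. R (P 0 i v) b \<noteq> 0})"
      by (auto simp: \<psi>_def intro: sum.neutral)
    then have "finite {b. \<psi> v b \<noteq> 0}"
      by (rule finite_subset) (auto simp: R_def V.finite_representation)
    moreover have "\<psi> v b = 0" if "b \<notin> B" for b
    proof -
      have "R u b = 0" for u using that V.representation_ne_zero[of B u b] unfolding R_def by blast
      then show ?thesis by (simp add: \<psi>_def)
    qed
    ultimately show ?thesis by (auto simp: dsum_sym_def degree_\<psi>)
  qed
  have \<psi>_inj: "u = v" if "\<psi> u = \<psi> v" for u v
  proof -
    have "P 0 i u = P 0 i v" if "i \<le> m" for i
    proof -
      have R_eq: "R (P 0 i u) = R (P 0 i v)"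
      proof
        fix b
        have "coeff (\<psi> u b) i = coeff (\<psi> v b) i" by (simp only: \<open>\<psi> u = \<psi> v\<close>)
        with that show "R (P 0 i u) b = R (P 0 i v) b" by (simp only: coeff_\<psi> if_True)
      qed
      have "P 0 i u = (\<Sum>b | R (P 0 i u) b \<noteq> 0. smul (R (P 0 i u) b) b)"
        unfolding R_def by (rule V.sum_nonzero_representation_eq[OF B(2) span, symmetric])
      also have "\<dots> = P 0 i v"
        unfolding R_eq unfolding R_def by (rule V.sum_nonzero_representation_eq[OF B(2) span])
      finally show ?thesis .
    qed
    \<comment> \<open>A vector is recovered from its coordinates by moving each one back from degree
      0 to degree \<open>i\<close> and summing.\<close>
    then have "(\<Sum>i\<le>m. P i 0 (P 0 i u)) = (\<Sum>i\<le>m. P i 0 (P 0 i v))" by simp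
    then show ?thesis by (simp add: P_P P_sum)
  qed
  have \<psi>_surj: "\<exists>v. \<psi> v = f" if f: "f \<in> dsum_sym UNIV m B" for f
  proof -
    define S where "S = {b. f b \<noteq> 0}"
    have S: "finite S" "S \<subseteq> B" using f by (auto simp: S_def dsum_sym_def)
    \<comment> \<open>The vector in the multiplicity space whose coordinates are the i-th
      coefficients of \<open>f\<close>; it is to become the i-th coordinate of the preimage.\<close>
    define w where "w i = (\<Sum>b\<in>S. smul (coeff (f b) i) b)" for i
    have w: "P 0 0 (w i) = w i" for i
    proof -
      have "P 0 0 b = b" if "b \<in> S" for b
        using that S(2) B(1) by (auto simp: P_P)
      then show ?thesis by (simp add: w_def Modules.additive.sum[OF additive_P] P_smul)
    qed
    have R_w: "R (w i) b = coeff (f b) i" for i b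
    proof -
      have "R (w i) b = (\<Sum>b'\<in>S. coeff (f b') i * (if b = b' then 1 else 0))"
        unfolding w_def R_def using B(2) S(2)
        by (subst V.representation_sum)
          (auto simp: V.representation_scale V.span_base V.span_scale V.representation_basis subset_iff intro!: sum.cong)
      also have "\<dots> = (if b \<in> S then coeff (f b) i else 0)"
        using S(1) by (simp add: if_distrib[of "(*) _"] cong: if_cong)
      finally show ?thesis by (simp add: S_def)
    qed
    define v where "v = (\<Sum>i\<le>m. P i 0 (w i))"
    have "P 0 i v = w i" if "i \<le> m" for i
      using that by (simp add: v_def Modules.additive.sum[OF additive_P] P_P w if_distrib cong: if_cong)
    then have "coeff (\<psi> v b) j = coeff (f b) j" for b j
      using f coeff_eq_0[of "f b" j]
      by (cases "b \<in> B") (auto simp: coeff_\<psi> R_w dsum_sym_def)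
    then show ?thesis by (auto simp: poly_eq_iff fun_eq_iff)
  qed
  have "is_sym_iso UNIV m smul act B \<psi>"
    unfolding is_sym_iso_def
  proof (intro conjI ballI allI)
    show "bij_betw \<psi> UNIV (dsum_sym UNIV m B)"
      using \<psi>_in \<psi>_inj \<psi>_surj by (fastforce simp: bij_betw_def inj_def)
    show "\<psi> (u + v) = (\<lambda>b. \<psi> u b + \<psi> v b)" for u v
      using B(2) span by (auto simp: fun_eq_iff poly_eq_iff coeff_\<psi> R_def Modules.additive.add[OF additive_P] V.representation_add)
    show "\<psi> (smul c v) = (\<lambda>b. smult c (\<psi> v b))" for c v
      using B(2) span by (auto simp: fun_eq_iff poly_eq_iff coeff_\<psi> R_def P_smul V.representation_scale)
    show "\<psi> (act g v) = (\<lambda>b. sym_act m g (\<psi> v b))" if g: "g \<in> SL2 UNIV" for g v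
    proof (intro ext poly_eqI)
      fix b j
      show "coeff (\<psi> (act g v) b) j = coeff (sym_act m g (\<psi> v b)) j"
      proof (cases "j \<le> m")
        case True
        with g B(2) span show ?thesis
          by (simp add: coeff_sym_act[OF degree_\<psi>] coeff_\<psi> R_def P_act
            V.representation_sum V.span_scale V.representation_scale)
      next
        case False
        then show ?thesis
          using degree_\<psi>[of "act g v" b] degree_sym_act[of m g "\<psi> v b"] by (simp add: coeff_eq_0)
      qed
    qed
  qed
  then show ?thesis by blast
qed

end

theorem theorem2:
  fixes n :: nat
    and act :: "'k::field^2^2 \<Rightarrow> 'v::ab_group_add \<Rightarrow> 'v"
    and smul1 :: "'k \<Rightarrow> 'v \<Rightarrow> 'v"
    and I :: "'i set"
    and \<phi> :: "'v \<Rightarrow> 'i \<Rightarrow> 'k poly"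
  assumes "n \<ge> 2"
    and "CHAR('k) = 0 \<or> CHAR('k) \<ge> 2 * n + 1"
    and "radically_closed (2 * dfact (n - 1)) TYPE('k)"
    and "is_G_module act"
    and "is_vs_over prime_subfield smul1"
    and "is_sym_iso prime_subfield (n - 1) smul1 act I \<phi>"
  shows "\<exists>smul :: 'k \<Rightarrow> 'v \<Rightarrow> 'v. is_vs_over UNIV smul \<and>
           (\<forall>c\<in>prime_subfield. \<forall>v. smul c v = smul1 c v) \<and>
           (\<exists>(J :: 'v set) (\<psi> :: 'v \<Rightarrow> 'v \<Rightarrow> 'k poly). is_sym_iso UNIV (n - 1) smul act J \<psi>)"
proof -
  \<comment> \<open>With m = n - 1, the bound 2n + 1 on a positive characteristic exceeds 2m +
    1.\<close>
  interpret sl2_sym_module "n - 1" act smul1 I \<phi>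
    using assms by unfold_locales auto
  show ?thesis
    using is_vs_over_smul smul_eq_smul1 sym_decomposition by blast
qed

end
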